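(* Let $G$ be a finite connected graph with vertices $v_1,\dots,v_n$ and $m$ edges, carrying data $H_{uu}$, $h$, $\gamma$ defining the Hermitian matrix $\mathbf{H}$ as in the context. Let $\Gamma$ be a finite group with $|\Gamma|=p$, let $\alpha:D(G)\to\Gamma$ be an ordinary voltage assignment, and let $\rho_1=1,\rho_2,\dots,\rho_k$ be the inequivalent irreducible representations of $\Gamma$, with $f_i=\deg\rho_i$ ($f_1=1$). Let $\lambda\in\mathbb{C}$ with $H_{uu}-\lambda-i\Gamma_u\neq0$ for all $u\in V(G)$. If the $\Gamma$-covering $G^\alpha$ is connected, then the bond scattering matrix $\tilde{\mathbf{U}}(\lambda)$ of $G^\alpha$ (with respect to the induced Hermitian matrix $\tilde{\mathbf{H}}$) satisfies \[ \det(\mathbf{I}_{2mp}-\tilde{\mathbf{U}}(\lambda))=\det(\mathbf{I}_{2m}-\mathbf{U}(\lambda))\prod_{i=2}^{k}\det\Bigl(\mathbf{I}_{2mf_i}-\sum_{h\in\Gamma}\rho_i(h)\otimes\mathbf{U}_h\Bigr)^{f_i} \] \[ =\frac{2^{mp}(-1)^{np}\det(\lambda\mathbf{I}_n-\mathbf{H})}{\prod_{u\in V(G)}(H_{uu}-\lambda-i\Gamma_u)^p}\prod_{i=2}^{k}\det\Bigl(\lambda\mathbf{I}_{nf_i}-\sum_{h\in\Gamma}\rho_i(h)\otimes\mathbf{H}_h-\mathbf{I}_{f_i}\otimes\mathrm{diag}(\mathbf{H})\Bigr)^{f_i}, \] where $\mathrm{diag}(\mathbf{H})$ is the diagonal matrix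 with entries $H_{v_1v_1},\dots,H_{v_nv_n}$.
   Context: $G$ is a finite connected graph without loops or multiple edges; $D(G)$ is its set of arcs ($2m$ of them); for $e=(u,v)$, $o(e)=u$, $t(e)=v$, $e^{-1}=(v,u)$. Data: real numbers $H_{uu}$ ($u\in V(G)$), $h:D(G)\to[0,\infty)$, $\gamma:D(G)\to[-\pi/2,\pi/2]$ with $h_{f^{-1}}=h_f$, $\gamma_{f^{-1}}=-\gamma_f$; write $h_{uv}=h_{(u,v)}$, $\gamma_{uv}=\gamma_{(u,v)}$. The Hermitian matrix $\mathbf{H}=(H_{uv})$ has diagonal $H_{uu}$ and, for $u\ne v$, $H_{uv}=h_{uv}e^{2i\gamma_{uv}}$ if $(u,v)\in D(G)$, else $0$. $\Gamma_u=\sum_{o(f)=u}h_f$. For a graph with such data, $\sigma^{(u)}_{ef}(\lambda)=i\delta_{e^{-1},f}-2\frac{\sqrt{h_e}\sqrt{h_f}}{H_{uu}-\lambda-i\Gamma_u}e^{i(\gamma_f+\gamma_e)}$, and the bond scattering matrix $\mathbf{U}(\lambda)=(U_{ef})_{e,f\in D(G)}$ has $U_{ef}=\sigma^{(t(e))}_{ef}(\lambda)$ if $t(e)=o(f)$, $0$ otherwise. An ordinary voltage assignment is a map $\alpha:D(G)\to\Gamma$ with $\alpha(v,u)=\alpha(u,v)^{-1}$. The derived graph ($\Gamma$-covering) $G^\alpha$ has vertex set $V(G)\times\Gamma$ and an arc $((u,g),(v,g\alpha(u,v)))$ for each $(u,v)\in D(G)$, $g\in\Gamma$. It carries the induced data: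 $\tilde H_{(u,g)(u,g)}=H_{uu}$, $\tilde h((u,g),(v,g\alpha(u,v)))=h_{uv}$, $\tilde\gamma((u,g),(v,g\alpha(u,v)))=\gamma_{uv}$, giving the Hermitian matrix $\tilde{\mathbf{H}}=\mathbf{H}(G^\alpha)$ and bond scattering matrix $\tilde{\mathbf{U}}(\lambda)$ of $G^\alpha$ defined in the same way. For $h\in\Gamma$: $\mathbf{H}_h=(H^{(h)}_{uv})$ is the $n\times n$ matrix with $H^{(h)}_{uv}=h_{uv}e^{2i\gamma_{uv}}$ if $(u,v)\in D(G)$ and $\alpha(u,v)=h$, else $0$; $\mathbf{U}_h$ is the $2m\times2m$ matrix with $(e,f)$-entry $\sigma^{(t(e))}_{ef}(\lambda)$ if $t(e)=o(f)$ and $\alpha(e)=h$, else $0$. $\mathbf{A}\otimes\mathbf{B}$ denotes the Kronecker product (each entry $a_{ij}$ of $\mathbf{A}$ replaced by $a_{ij}\mathbf{B}$). *)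

theory Defs
  imports
    "Graph_Theory.Graph_Theory"
    "Jordan_Normal_Form.DL_Rank"
    "HOL-Algebra.Coset"
    Complex_Main
begin

text \<open>
  Simple graphs are the symmetric, loop-free, finite digraphs with pairs as arcs
  (\<^locale>\<open>pair_graph\<close>); an arc \<open>e = (u,v)\<close> has origin \<open>fst e\<close>, terminus \<open>snd e\<close> and
  inverse \<open>prod.swap e\<close>. A matrix indexed by a finite set is read off along a list that
  enumerates the set without repetition.
\<close>

definition index_mat :: "'i list \<Rightarrow> ('i \<Rightarrow> 'i \<Rightarrow> complex) \<Rightarrow> complex mat" where
  "index_mat xs F = mat (length xs) (length xs) (\<lambda>(i, j). F (xs ! i) (xs ! j))"

definition enumerates :: "'i list \<Rightarrow> 'i set \<Rightarrow> bool" where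
  "enumerates xs S \<longleftrightarrow> distinct xs \<and> set xs = S"

definition kronecker :: "complex mat \<Rightarrow> complex mat \<Rightarrow> complex mat" (infixl "\<otimes>\<^sub>K" 70) where
  "A \<otimes>\<^sub>K B = mat (dim_row A * dim_row B) (dim_col A * dim_col B)
     (\<lambda>(i, j). A $$ (i div dim_row B, j div dim_col B) * B $$ (i mod dim_row B, j mod dim_col B))"


subsection \<open>Hermitian matrix and bond scattering matrix\<close>

definition arc_data :: "'a pair_pre_digraph \<Rightarrow> ('a \<times> 'a \<Rightarrow> real) \<Rightarrow> ('a \<times> 'a \<Rightarrow> real) \<Rightarrow> bool" where
  "arc_data G h \<gamma> \<longleftrightarrow> (\<forall>e \<in> parcs G.
     0 \<le> h e \<and> h (prod.swap e) = h e \<and>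
     - (pi / 2) \<le> \<gamma> e \<and> \<gamma> e \<le> pi / 2 \<and> \<gamma> (prod.swap e) = - \<gamma> e)"

definition hermitian_mat ::
  "'a pair_pre_digraph \<Rightarrow> ('a \<Rightarrow> real) \<Rightarrow> ('a \<times> 'a \<Rightarrow> real) \<Rightarrow> ('a \<times> 'a \<Rightarrow> real) \<Rightarrow> 'a list \<Rightarrow> complex mat"
where
  "hermitian_mat G H h \<gamma> vs = index_mat vs (\<lambda>u v.
     if u = v then of_real (H u)
     else if (u, v) \<in> parcs G then of_real (h (u, v)) * exp (2 * \<i> * of_real (\<gamma> (u, v)))
     else 0)"

definition out_weight :: "'a pair_pre_digraph \<Rightarrow> ('a \<times> 'a \<Rightarrow> real) \<Rightarrow> 'a \<Rightarrow> real" where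
  "out_weight G h u = (\<Sum>f \<in> {f \<in> parcs G. fst f = u}. h f)"

definition resolvent_denom ::
  "'a pair_pre_digraph \<Rightarrow> ('a \<Rightarrow> real) \<Rightarrow> ('a \<times> 'a \<Rightarrow> real) \<Rightarrow> complex \<Rightarrow> 'a \<Rightarrow> complex"
where
  "resolvent_denom G H h \<mu> u = of_real (H u) - \<mu> - \<i> * of_real (out_weight G h u)"

definition scattering ::
  "'a pair_pre_digraph \<Rightarrow> ('a \<Rightarrow> real) \<Rightarrow> ('a \<times> 'a \<Rightarrow> real) \<Rightarrow> ('a \<times> 'a \<Rightarrow> real) \<Rightarrow> complex
    \<Rightarrow> 'a \<Rightarrow> 'a \<times> 'a \<Rightarrow> 'a \<times> 'a \<Rightarrow> complex"
where
  "scattering G H h \<gamma> \<mu> u e f =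
     \<i> * (if prod.swap e = f then 1 else 0)
     - 2 * (of_real (sqrt (h e)) * of_real (sqrt (h f)) / resolvent_denom G H h \<mu> u)
         * exp (\<i> * of_real (\<gamma> f + \<gamma> e))"

definition bond_scattering_mat ::
  "'a pair_pre_digraph \<Rightarrow> ('a \<Rightarrow> real) \<Rightarrow> ('a \<times> 'a \<Rightarrow> real) \<Rightarrow> ('a \<times> 'a \<Rightarrow> real) \<Rightarrow> complex
    \<Rightarrow> ('a \<times> 'a) list \<Rightarrow> complex mat"
where
  "bond_scattering_mat G H h \<gamma> \<mu> es = index_mat es (\<lambda>e f.
     if snd e = fst f then scattering G H h \<gamma> \<mu> (snd e) e f else 0)"


subsection \<open>Voltage assignments and derived graphs\<close>

definition voltage_assignment ::
  "'a pair_pre_digraph \<Rightarrow> ('g, 'b) monoid_scheme \<Rightarrow> ('a \<times> 'a \<Rightarrow> 'g) \<Rightarrow> bool"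
where
  "voltage_assignment G \<Gamma> \<alpha> \<longleftrightarrow>
     (\<forall>e \<in> parcs G. \<alpha> e \<in> carrier \<Gamma> \<and> \<alpha> (prod.swap e) = inv\<^bsub>\<Gamma>\<^esub> (\<alpha> e))"

definition derived_graph ::
  "'a pair_pre_digraph \<Rightarrow> ('g, 'b) monoid_scheme \<Rightarrow> ('a \<times> 'a \<Rightarrow> 'g) \<Rightarrow> ('a \<times> 'g) pair_pre_digraph"
where
  "derived_graph G \<Gamma> \<alpha> =
     \<lparr> pverts = pverts G \<times> carrier \<Gamma>,
       parcs = {((u, g), (v, g \<otimes>\<^bsub>\<Gamma>\<^esub> \<alpha> (u, v))) | u v g. (u, v) \<in> parcs G \<and> g \<in> carrier \<Gamma>} \<rparr>"

definition lift_vertex_data :: "('a \<Rightarrow> real) \<Rightarrow> 'a \<times> 'g \<Rightarrow> real" where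
  "lift_vertex_data H = (\<lambda>(u, g). H u)"

definition lift_arc_data :: "('a \<times> 'a \<Rightarrow> real) \<Rightarrow> ('a \<times> 'g) \<times> ('a \<times> 'g) \<Rightarrow> real" where
  "lift_arc_data h = (\<lambda>((u, g), (v, g')). h (u, v))"

definition hermitian_part_mat ::
  "'a pair_pre_digraph \<Rightarrow> ('a \<times> 'a \<Rightarrow> real) \<Rightarrow> ('a \<times> 'a \<Rightarrow> real) \<Rightarrow> ('a \<times> 'a \<Rightarrow> 'g) \<Rightarrow> 'g
    \<Rightarrow> 'a list \<Rightarrow> complex mat"
where
  "hermitian_part_mat G h \<gamma> \<alpha> g vs = index_mat vs (\<lambda>u v.
     if (u, v) \<in> parcs G \<and> \<alpha> (u, v) = g
     then of_real (h (u, v)) * exp (2 * \<i> * of_real (\<gamma> (u, v))) else 0)"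

definition bond_scattering_part_mat ::
  "'a pair_pre_digraph \<Rightarrow> ('a \<Rightarrow> real) \<Rightarrow> ('a \<times> 'a \<Rightarrow> real) \<Rightarrow> ('a \<times> 'a \<Rightarrow> real) \<Rightarrow> complex
    \<Rightarrow> ('a \<times> 'a \<Rightarrow> 'g) \<Rightarrow> 'g \<Rightarrow> ('a \<times> 'a) list \<Rightarrow> complex mat"
where
  "bond_scattering_part_mat G H h \<gamma> \<mu> \<alpha> g es = index_mat es (\<lambda>e f.
     if snd e = fst f \<and> \<alpha> e = g then scattering G H h \<gamma> \<mu> (snd e) e f else 0)"


subsection \<open>Complex matrix representations of a group\<close>

text \<open>\<open>units_of (ring_mat TYPE(complex) d ())\<close> is the general linear group of degree \<open>d\<close> over the complex numbers.\<close>

definition group_representation :: "('g, 'b) monoid_scheme \<Rightarrow> nat \<Rightarrow> ('g \<Rightarrow> complex mat) \<Rightarrow> bool" where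
  "group_representation \<Gamma> d \<rho> \<longleftrightarrow> \<rho> \<in> hom \<Gamma> (units_of (ring_mat TYPE(complex) d ()))"

definition irreducible_representation ::
  "('g, 'b) monoid_scheme \<Rightarrow> nat \<Rightarrow> ('g \<Rightarrow> complex mat) \<Rightarrow> bool"
where
  "irreducible_representation \<Gamma> d \<rho> \<longleftrightarrow>
     group_representation \<Gamma> d \<rho> \<and> 0 < d \<and>
     (\<forall>W. subspace class_ring W (module_vec TYPE(complex) d) \<and>
          (\<forall>g \<in> carrier \<Gamma>. \<forall>w \<in> W. \<rho> g *\<^sub>v w \<in> W)
        \<longrightarrow> W = {0\<^sub>v d} \<or> W = carrier_vec d)"

definition equivalent_representations ::
  "('g, 'b) monoid_scheme \<Rightarrow> nat \<Rightarrow> ('g \<Rightarrow> complex mat) \<Rightarrow> nat \<Rightarrow> ('g \<Rightarrow> complex mat) \<Rightarrow> bool"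
where
  "equivalent_representations \<Gamma> d \<rho> d' \<rho>' \<longleftrightarrow>
     d = d' \<and> (\<exists>P \<in> Units (ring_mat TYPE(complex) d ()).
       \<forall>g \<in> carrier \<Gamma>. P * \<rho> g = \<rho>' g * P)"

definition all_irreducible_representations ::
  "('g, 'b) monoid_scheme \<Rightarrow> nat \<Rightarrow> (nat \<Rightarrow> nat) \<Rightarrow> (nat \<Rightarrow> 'g \<Rightarrow> complex mat) \<Rightarrow> bool"
where
  "all_irreducible_representations \<Gamma> k f \<rho> \<longleftrightarrow>
     (\<forall>i \<in> {1..k}. irreducible_representation \<Gamma> (f i) (\<rho> i)) \<and>
     (\<forall>i \<in> {1..k}. \<forall>j \<in> {1..k}. i \<noteq> j \<longrightarrow>
        \<not> equivalent_representations \<Gamma> (f i) (\<rho> i) (f j) (\<rho> j)) \<and>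
     (\<forall>d \<sigma>. irreducible_representation \<Gamma> d \<sigma> \<longrightarrow>
        (\<exists>i \<in> {1..k}. equivalent_representations \<Gamma> d \<sigma> (f i) (\<rho> i)))"

end

theory Submission
  imports Defs "Jordan_Normal_Form.Spectral_Radius"
begin

text \<open>
  Twisting by a representation \<open>\<rho>\<close> turns the bond scattering matrix into
  \<open>c J - (1 - c\<^sup>2) T D\<inverse> O\<close> with \<open>c = \<i>\<close>, where \<open>J\<close> is the twisted arc reversal, an involution,
  \<open>D\<close> is the diagonal of resolvent denominators, and \<open>T\<close> (which carries the twist) and \<open>O\<close> are
  weighted incidences of arcs with their end and start vertices. Since
  \<open>(1 - c J) (1 + c J) = 1 - c\<^sup>2\<close>, one minus this matrix is
  \<open>(1 - c J) (1 + (1 + c J) T D\<inverse> O)\<close>. The first factor has determinant \<open>(1 - c\<^sup>2) ^ (m deg \<rho>)\<close>, and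
  \<open>det (1 + X Y) = det (1 + Y X)\<close> moves the second one to the vertices, where \<open>D + O (1 + c J) T\<close>
  is the twisted Hermitian matrix minus the spectral parameter.

  The covering is the twist by the regular representation. A reducible representation is block
  triangular in a suitable basis, so its trace is the sum and its twisted determinant the product
  over its composition factors; complete reducibility is not needed. By the orthogonality of
  characters \<open>\<rho>\<^sub>i\<close> occurs \<open>f\<^sub>i\<close> times in the regular representation, which is Frobenius' factorization
  of the group determinant with matrices in place of the variables.
\<close>

section \<open>Determinants over finite index sets\<close>

lemma det_four_block_mat_one_upper_left:
  fixes B C D :: "'a :: idom mat"
  assumes B: "B \<in> carrier_mat n m" and C: "C \<in> carrier_mat m n" and D: "D \<in> carrier_mat m m"
  shows "det (four_block_mat (1\<^sub>m n) B C D) = det (D - C * B)"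
proof -
  let ?L = "four_block_mat (1\<^sub>m n) (0\<^sub>m n m) C (1\<^sub>m m)"
  let ?R = "four_block_mat (1\<^sub>m n) B (0\<^sub>m m n) (D - C * B)"
  have carrier: "?L \<in> carrier_mat (n + m) (n + m)" "?R \<in> carrier_mat (n + m) (n + m)"
    using B C D by auto
  have "?L * ?R = four_block_mat (1\<^sub>m n) B C D"
    by (subst mult_four_block_mat[of _ n n _ m _ m]) (use B C D in \<open>auto intro!: cong_four_block_mat\<close>)
  moreover have "det ?L = 1"
    using C by (subst det_four_block_mat_upper_right_zero[of _ n _ m]) auto
  moreover have "det ?R = det (D - C * B)"
    using B C D by (subst det_four_block_mat_lower_left_zero[of _ n _ m]) auto
  ultimately show ?thesis
    using det_mult[OF carrier] by simp
qed

lemma det_four_block_mat_one_lower_right: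
  fixes A B C :: "'a :: idom mat"
  assumes A: "A \<in> carrier_mat n n" and B: "B \<in> carrier_mat n m" and C: "C \<in> carrier_mat m n"
  shows "det (four_block_mat A B C (1\<^sub>m m)) = det (A - B * C)"
proof -
  let ?L = "four_block_mat (1\<^sub>m n) B (0\<^sub>m m n) (1\<^sub>m m)"
  let ?R = "four_block_mat (A - B * C) (0\<^sub>m n m) C (1\<^sub>m m)"
  have carrier: "?L \<in> carrier_mat (n + m) (n + m)" "?R \<in> carrier_mat (n + m) (n + m)"
    using A B C by auto
  have "?L * ?R = four_block_mat A B C (1\<^sub>m m)"
    by (subst mult_four_block_mat[of _ n n _ m _ m]) (use A B C in \<open>auto intro!: cong_four_block_mat\<close>)
  moreover have "det ?L = 1"
    using B by (subst det_four_block_mat_lower_left_zero[of _ n _ m]) auto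
  moreover have "det ?R = det (A - B * C)"
    using A B C by (subst det_four_block_mat_upper_right_zero[of _ n _ m]) auto
  ultimately show ?thesis
    using det_mult[OF carrier] by simp
qed

lemma det_one_add_mult_commute:
  fixes A B :: "'a :: idom mat"
  assumes A: "A \<in> carrier_mat n m" and B: "B \<in> carrier_mat m n"
  shows "det (1\<^sub>m n + A * B) = det (1\<^sub>m m + B * A)"
proof -
  have "1\<^sub>m n + A * B = 1\<^sub>m n - - A * B" "1\<^sub>m m + B * A = 1\<^sub>m m - B * - A"
    using A B by auto
  then show ?thesis
    using det_four_block_mat_one_upper_left[of "- A" n m B "1\<^sub>m m"]
      det_four_block_mat_one_lower_right[of "1\<^sub>m n" n "- A" m B] A B by simp
qed

definition det_on :: "'i set \<Rightarrow> ('i \<Rightarrow> 'i \<Rightarrow> 'a :: comm_ring_1) \<Rightarrow> 'a" where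
  "det_on S F = (\<Sum>\<pi> | \<pi> permutes S. of_int (sign \<pi>) * (\<Prod>x\<in>S. F x (\<pi> x)))"

definition kdelta :: "'i \<Rightarrow> 'i \<Rightarrow> 'a :: {zero,one}" where
  "kdelta x y = (if x = y then 1 else 0)"

definition mult_on :: "'j set \<Rightarrow> ('i \<Rightarrow> 'j \<Rightarrow> 'a) \<Rightarrow> ('j \<Rightarrow> 'k \<Rightarrow> 'a) \<Rightarrow> 'i \<Rightarrow> 'k \<Rightarrow> 'a :: semiring_0" where
  "mult_on T F K x z = (\<Sum>y\<in>T. F x y * K y z)"

definition rect_mat :: "'i list \<Rightarrow> 'j list \<Rightarrow> ('i \<Rightarrow> 'j \<Rightarrow> 'a) \<Rightarrow> 'a mat" where
  "rect_mat xs ys F = mat (length xs) (length ys) (\<lambda>(i, j). F (xs ! i) (ys ! j))"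

lemma kdelta_refl [simp]: "kdelta x x = 1"
  by (simp add: kdelta_def)

lemma kdelta_Pair: "kdelta (x, y) (x', y') = kdelta x x' * (kdelta y y' :: 'a :: semiring_1)"
  by (simp add: kdelta_def)

lemma sum_kdelta [simp]:
  fixes F :: "'i \<Rightarrow> 'a :: semiring_1"
  assumes "finite S"
  shows "(\<Sum>y\<in>S. kdelta x y * F y) = (if x \<in> S then F x else 0)"
    and "(\<Sum>y\<in>S. F y * kdelta x y) = (if x \<in> S then F x else 0)"
    and "(\<Sum>y\<in>S. kdelta y x * F y) = (if x \<in> S then F x else 0)"
    and "(\<Sum>y\<in>S. F y * kdelta y x) = (if x \<in> S then F x else 0)"
  using assms by (simp_all add: kdelta_def if_distrib if_distribR sum.delta sum.delta' cong: if_cong)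

lemma mult_on_assoc: "mult_on T (mult_on S F K) L x z = mult_on S F (mult_on T K L) x z"
  unfolding mult_on_def sum_distrib_left sum_distrib_right by (subst sum.swap) (simp add: mult.assoc)

definition kron :: "('i \<Rightarrow> 'k \<Rightarrow> 'a) \<Rightarrow> ('j \<Rightarrow> 'l \<Rightarrow> 'a) \<Rightarrow> 'i \<times> 'j \<Rightarrow> 'k \<times> 'l \<Rightarrow> 'a :: times" where
  "kron F K = (\<lambda>(x, u) (y, v). F x y * K u v)"

lemma mult_on_kron:
  fixes F :: "'i \<Rightarrow> 'k \<Rightarrow> 'a :: comm_semiring_0"
  shows "mult_on (S \<times> T) (kron F K) (kron F' K') = kron (mult_on S F F') (mult_on T K K')"
  by (intro ext)
    (auto simp: mult_on_def kron_def sum.cartesian_product' sum_product mult.assoc mult.left_commute)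

lemma mult_on_kdelta:
  fixes F :: "'i \<Rightarrow> 'j \<Rightarrow> 'a :: semiring_1"
  shows "finite S \<Longrightarrow> x \<in> S \<Longrightarrow> mult_on S kdelta F x y = F x y"
    and "finite T \<Longrightarrow> y \<in> T \<Longrightarrow> mult_on T F kdelta x y = F x y"
  by (simp_all add: mult_on_def)

lemma mult_on_sum_right: "mult_on S F (\<lambda>x y. \<Sum>g\<in>A. K g x y) x z = (\<Sum>g\<in>A. mult_on S F (K g) x z)"
  unfolding mult_on_def sum_distrib_left by (rule sum.swap)

lemma mult_on_sum_left: "mult_on S (\<lambda>x y. \<Sum>g\<in>A. F g x y) K x z = (\<Sum>g\<in>A. mult_on S (F g) K x z)"
  unfolding mult_on_def sum_distrib_right by (rule sum.swap)

lemma mult_on_add_right: "mult_on S F (\<lambda>x y. K x y + L x y) x z = mult_on S F K x z + mult_on S F L x z"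
  by (simp add: mult_on_def distrib_left sum.distrib)

lemma mult_on_kdelta_diff:
  fixes F :: "'i \<Rightarrow> 'i \<Rightarrow> 'a :: comm_ring_1"
  assumes "finite S" "x \<in> S"
  shows "mult_on S (\<lambda>x y. kdelta x y - c * F x y) K x z = K x z - c * mult_on S F K x z"
  using assms by (simp add: mult_on_def left_diff_distrib sum_subtractf sum_distrib_left mult.assoc)

lemma rect_mat_carrier [simp]: "rect_mat xs ys F \<in> carrier_mat (length xs) (length ys)"
  by (simp add: rect_mat_def)

lemma index_mat_eq_rect_mat: "index_mat xs = rect_mat xs xs"
  by (intro ext) (simp add: rect_mat_def index_mat_def)

lemma enumerates_exists: "finite S \<Longrightarrow> \<exists>xs. enumerates xs S"
  using finite_distinct_list[of S] by (auto simp: enumerates_def)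

lemma finite_enumerates: "enumerates xs S \<Longrightarrow> finite S"
  by (metis enumerates_def List.finite_set)

lemma length_enumerates: "enumerates xs S \<Longrightarrow> length xs = card S"
  by (auto simp: enumerates_def distinct_card)

lemma bij_betw_nth_enumerates: "enumerates xs S \<Longrightarrow> bij_betw ((!) xs) {0..<length xs} S"
  unfolding enumerates_def using bij_betw_nth[of xs "{0..<length xs}" S]
  by (auto simp: lessThan_atLeast0)

lemma rect_mat_mult:
  assumes "enumerates ys T"
  shows "rect_mat xs ys F * rect_mat ys zs K = rect_mat xs zs (mult_on T F K)"
proof (rule eq_matI)
  fix i j assume "i < dim_row (rect_mat xs zs (mult_on T F K))"
    "j < dim_col (rect_mat xs zs (mult_on T F K))"
  then show "(rect_mat xs ys F * rect_mat ys zs K) $$ (i, j) = rect_mat xs zs (mult_on T F K) $$ (i, j)"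
    using sum.reindex_bij_betw[OF bij_betw_nth_enumerates[OF assms],
        of "\<lambda>y. F (xs ! i) y * K y (zs ! j)"]
    by (simp add: rect_mat_def scalar_prod_def mult_on_def)
qed (simp_all add: rect_mat_def)

lemma rect_mat_cong:
  assumes "\<And>x y. x \<in> set xs \<Longrightarrow> y \<in> set ys \<Longrightarrow> F x y = K x y"
  shows "rect_mat xs ys F = rect_mat xs ys K"
  by (rule eq_matI) (auto simp: rect_mat_def assms)

lemma rect_mat_add: "rect_mat xs ys F + rect_mat xs ys K = rect_mat xs ys (\<lambda>x y. F x y + K x y)"
  by (rule eq_matI) (auto simp: rect_mat_def)

lemma rect_mat_diff: "rect_mat xs ys F - rect_mat xs ys K = rect_mat xs ys (\<lambda>x y. F x y - K x y)"
  by (rule eq_matI) (auto simp: rect_mat_def)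

lemma rect_mat_kdelta: "distinct xs \<Longrightarrow> rect_mat xs xs kdelta = 1\<^sub>m (length xs)"
  by (rule eq_matI) (auto simp: rect_mat_def kdelta_def nth_eq_iff_index_eq)

lemma det_on_reindex:
  assumes fin: "finite S" and b: "bij_betw b S T"
  shows "det_on S (\<lambda>x y. F (b x) (b y)) = det_on T F"
  unfolding det_on_def
proof (rule sum.reindex_bij_witness[where j = "map_permutation S b"
      and i = "map_permutation T (inv_into S b)"])
  note inj = bij_betw_imp_inj_on[OF b]
  have inv: "bij_betw (inv_into S b) T S" using b by (rule bij_betw_inv_into)
  fix \<pi> assume "\<pi> \<in> {\<pi>. \<pi> permutes S}"
  then have \<pi>: "\<pi> permutes S" by simp
  show "map_permutation T (inv_into S b) (map_permutation S b \<pi>) = \<pi>"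
    using map_permutation_compose_inv[OF b \<pi>] inj by simp
  show "map_permutation S b \<pi> \<in> {\<pi>. \<pi> permutes T}"
    using map_permutation_permutes[OF b \<pi>] by simp
  have "(\<Prod>x\<in>T. F x (map_permutation S b \<pi> x)) = (\<Prod>x\<in>S. F (b x) (b (\<pi> x)))"
    by (subst prod.reindex_bij_betw[OF b, symmetric]) (simp add: map_permutation_apply inj)
  then show "of_int (sign (map_permutation S b \<pi>)) * (\<Prod>x\<in>T. F x (map_permutation S b \<pi> x)) =
      of_int (sign \<pi>) * (\<Prod>x\<in>S. F (b x) (b (\<pi> x)))"
    using sign_map_permutation[OF inj \<pi> fin] by simp
next
  have inv: "bij_betw (inv_into S b) T S" using b by (rule bij_betw_inv_into)
  fix \<pi> assume "\<pi> \<in> {\<pi>. \<pi> permutes T}"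
  then have \<pi>: "\<pi> permutes T" by simp
  show "map_permutation S b (map_permutation T (inv_into S b) \<pi>) = \<pi>"
    using map_permutation_compose_inv[OF inv \<pi>] b by (simp add: bij_betw_inv_into_right)
  show "map_permutation T (inv_into S b) \<pi> \<in> {\<pi>. \<pi> permutes S}"
    using map_permutation_permutes[OF inv \<pi>] by simp
qed

lemma det_rect_mat:
  assumes xs: "enumerates xs S"
  shows "det (rect_mat xs xs F) = det_on S F"
proof -
  have "det (rect_mat xs xs F) = det_on {0..<length xs} (\<lambda>i j. F (xs ! i) (xs ! j))"
    unfolding det_def'[OF rect_mat_carrier] det_on_def
  proof (intro sum.cong refl)
    fix \<pi> assume "\<pi> \<in> {\<pi>. \<pi> permutes {0..<length xs}}"
    then have "\<pi> i < length xs" if "i < length xs" for i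
      using permutes_in_image[of \<pi> "{0..<length xs}" i] that by simp
    then show "of_int (sign \<pi>) * (\<Prod>i = 0..<length xs. rect_mat xs xs F $$ (i, \<pi> i)) =
        of_int (sign \<pi>) * (\<Prod>i = 0..<length xs. F (xs ! i) (xs ! \<pi> i))"
      by (simp add: rect_mat_def)
  qed
  also have "\<dots> = det_on S F"
    by (rule det_on_reindex[OF _ bij_betw_nth_enumerates[OF xs]]) simp
  finally show ?thesis .
qed

lemma det_on_cong:
  assumes "\<And>x y. x \<in> S \<Longrightarrow> y \<in> S \<Longrightarrow> F x y = K x y"
  shows "det_on S F = det_on S K"
  unfolding det_on_def using assms
  by (intro sum.cong refl arg_cong2[where f = "(*)"] prod.cong) (simp_all add: permutes_in_image)

lemma det_on_kdelta:
  assumes "finite S"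
  shows "det_on S kdelta = (1 :: 'a :: idom)"
proof -
  obtain xs where xs: "enumerates xs S" using enumerates_exists assms by auto
  then show ?thesis
    by (simp add: rect_mat_kdelta enumerates_def flip: det_rect_mat[OF xs])
qed

lemma det_on_uminus: "det_on S (\<lambda>x y. - F x y) = (-1) ^ card S * det_on S F"
  by (simp add: det_on_def prod_uminus sum_distrib_left mult.left_commute)

lemma det_on_mult_diagonal: "det_on S (\<lambda>x y. F x y * d y) = det_on S F * prod d S"
proof -
  have "(\<Prod>x\<in>S. F x (\<pi> x) * d (\<pi> x)) = (\<Prod>x\<in>S. F x (\<pi> x)) * prod d S" if "\<pi> permutes S" for \<pi>
    using prod.permute[OF that, of d] by (simp add: prod.distrib o_def)
  then show ?thesis
    by (simp add: det_on_def sum_distrib_right mult.assoc)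
qed

lemma det_on_mult:
  assumes "finite S"
  shows "det_on S (mult_on S F K) = det_on S F * det_on S (K :: 'i \<Rightarrow> 'i \<Rightarrow> 'a :: idom)"
proof -
  obtain xs where xs: "enumerates xs S" using enumerates_exists assms by auto
  show ?thesis
    unfolding det_rect_mat[OF xs, symmetric] rect_mat_mult[OF xs, symmetric]
    by (rule det_mult[of _ "length xs"]) auto
qed

lemma det_on_one_add_mult_commute:
  fixes A :: "'i \<Rightarrow> 'j \<Rightarrow> 'a :: idom"
  assumes "finite S" "finite T"
  shows "det_on S (\<lambda>x x'. kdelta x x' + mult_on T A B x x') =
      det_on T (\<lambda>y y'. kdelta y y' + mult_on S B A y y')"
proof -
  obtain xs ys where xs: "enumerates xs S" and ys: "enumerates ys T"
    using enumerates_exists assms by meson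
  have "distinct xs" "distinct ys" using xs ys by (simp_all add: enumerates_def)
  then show ?thesis
    using det_one_add_mult_commute[OF rect_mat_carrier rect_mat_carrier, of xs ys A B]
    by (simp add: rect_mat_mult[OF xs] rect_mat_mult[OF ys] rect_mat_add
      flip: det_rect_mat[OF xs] det_rect_mat[OF ys] rect_mat_kdelta)
qed

lemma rect_mat_append:
  "rect_mat (xs @ ys) (xs @ ys) F =
     four_block_mat (rect_mat xs xs F) (rect_mat xs ys F) (rect_mat ys xs F) (rect_mat ys ys F)"
  by (rule eq_matI) (auto simp: rect_mat_def nth_append)

lemma enumerates_append:
  "enumerates xs S \<Longrightarrow> enumerates ys T \<Longrightarrow> S \<inter> T = {} \<Longrightarrow> enumerates (xs @ ys) (S \<union> T)"
  by (auto simp: enumerates_def)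

lemma det_on_Un_block_triangular:
  fixes F :: "'i \<Rightarrow> 'i \<Rightarrow> 'a :: idom"
  assumes fin: "finite S" "finite T" and disj: "S \<inter> T = {}"
    and zero: "\<And>x y. x \<in> T \<Longrightarrow> y \<in> S \<Longrightarrow> F x y = 0"
  shows "det_on (S \<union> T) F = det_on S F * det_on T F"
proof -
  obtain xs ys where xs: "enumerates xs S" and ys: "enumerates ys T"
    using enumerates_exists fin by meson
  have "rect_mat ys xs F = 0\<^sub>m (length ys) (length xs)"
    using xs ys zero by (intro eq_matI) (auto simp: rect_mat_def enumerates_def)
  then show ?thesis
    unfolding det_rect_mat[OF enumerates_append[OF xs ys disj], symmetric]
      det_rect_mat[OF xs, symmetric] det_rect_mat[OF ys, symmetric] rect_mat_append
    by (intro det_four_block_mat_lower_left_zero) auto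
qed

lemma det_on_Un_schur_complement:
  fixes F :: "'i \<Rightarrow> 'i \<Rightarrow> 'a :: idom"
  assumes fin: "finite S" "finite T" and disj: "S \<inter> T = {}"
    and one: "\<And>x y. x \<in> S \<Longrightarrow> y \<in> S \<Longrightarrow> F x y = kdelta x y"
  shows "det_on (S \<union> T) F = det_on T (\<lambda>x y. F x y - mult_on S F F x y)"
proof -
  obtain xs ys where xs: "enumerates xs S" and ys: "enumerates ys T"
    using enumerates_exists fin by meson
  have "rect_mat xs xs F = rect_mat xs xs kdelta"
    using xs one by (intro rect_mat_cong) (simp add: enumerates_def)
  then have "rect_mat xs xs F = 1\<^sub>m (length xs)"
    using xs by (simp add: rect_mat_kdelta enumerates_def)
  then show ?thesis
    unfolding det_rect_mat[OF enumerates_append[OF xs ys disj], symmetric]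
      det_rect_mat[OF ys, symmetric] rect_mat_append
    by (simp add: det_four_block_mat_one_upper_left[of _ _ "length ys"] rect_mat_mult[OF xs]
        rect_mat_diff)
qed

section \<open>Irreducible representations and Schur orthogonality\<close>

lemma index_mult_mat_sum:
  assumes "A \<in> carrier_mat n m" "B \<in> carrier_mat m k" "i < n" "j < k"
  shows "(A * B) $$ (i, j) = (\<Sum>l<m. A $$ (i, l) * B $$ (l, j))"
  unfolding lessThan_atLeast0 using assms by (auto simp: scalar_prod_def)

lemma mult_mat_vec_unit_vec:
  fixes A :: "'a :: semiring_1 mat"
  assumes "A \<in> carrier_mat n m" "j < m"
  shows "A *\<^sub>v unit_vec m j = col A j"
  using assms by (intro eq_vecI) auto

definition mat_trace :: "'a :: comm_monoid_add mat \<Rightarrow> 'a" where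
  "mat_trace A = (\<Sum>i<dim_row A. A $$ (i, i))"

lemma mat_trace_one: "mat_trace (1\<^sub>m n) = (of_nat n :: 'a :: semiring_1)"
  by (simp add: mat_trace_def)

lemma mat_trace_mult_commute:
  fixes A B :: "'a :: comm_semiring_0 mat"
  assumes A: "A \<in> carrier_mat n m" and B: "B \<in> carrier_mat m n"
  shows "mat_trace (A * B) = mat_trace (B * A)"
proof -
  have "mat_trace (A * B) = (\<Sum>i<n. \<Sum>j<m. A $$ (i, j) * B $$ (j, i))"
    using A by (simp add: mat_trace_def index_mult_mat_sum[OF A B] del: index_mult_mat(1))
  also have "\<dots> = (\<Sum>j<m. \<Sum>i<n. B $$ (j, i) * A $$ (i, j))"
    by (subst sum.swap) (simp add: mult.commute)
  also have "\<dots> = mat_trace (B * A)"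
    using B by (simp add: mat_trace_def index_mult_mat_sum[OF B A] del: index_mult_mat(1))
  finally show ?thesis .
qed

lemma bijective_mat_invertible:
  fixes A :: "'a :: field_char_0 mat"
  assumes A: "A \<in> carrier_mat n m"
    and inj: "\<And>v. v \<in> carrier_vec m \<Longrightarrow> A *\<^sub>v v = 0\<^sub>v n \<Longrightarrow> v = 0\<^sub>v m"
    and surj: "\<And>w. w \<in> carrier_vec n \<Longrightarrow> \<exists>v\<in>carrier_vec m. A *\<^sub>v v = w"
  obtains B where "n = m" "B \<in> carrier_mat m n" "A * B = 1\<^sub>m n" "B * A = 1\<^sub>m m"
proof -
  obtain s where s: "\<And>j. s j \<in> carrier_vec m" "\<And>j. A *\<^sub>v s j = unit_vec n j"
    using surj[OF unit_vec_carrier] by metis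
  define B where "B = mat_of_cols m (map s [0..<n])"
  have B: "B \<in> carrier_mat m n" unfolding B_def by (rule carrier_matI) simp_all
  have AB: "A * B = 1\<^sub>m n"
  proof (rule mat_col_eqI)
    show "col (A * B) j = col (1\<^sub>m n) j" if "j < dim_col (1\<^sub>m n :: 'a mat)" for j
      using that s by (simp add: col_mult2[OF A B], simp add: B_def)
  qed (use A B in auto)
  have BA: "B * A = 1\<^sub>m m"
  proof (rule mat_col_eqI)
    fix j assume "j < dim_col (1\<^sub>m m :: 'a mat)"
    then have j: "j < m" by simp
    let ?v = "col (B * A) j - unit_vec m j"
    have v: "?v \<in> carrier_vec m" using A B j by auto
    have "A *\<^sub>v col (B * A) j = A *\<^sub>v (B *\<^sub>v col A j)"
      by (simp add: col_mult2[OF B A j])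
    also have "\<dots> = A *\<^sub>v unit_vec m j"
      using A j AB by (simp add: mult_mat_vec_unit_vec[OF A] flip: assoc_mult_mat_vec[OF A B])
    finally have "A *\<^sub>v ?v = 0\<^sub>v n"
      using A B j by (subst mult_minus_distrib_mat_vec[OF A]) auto
    then have zero: "?v = 0\<^sub>v m" by (rule inj[OF v])
    show "col (B * A) j = col (1\<^sub>m m) j"
    proof (rule eq_vecI)
      fix i assume "i < dim_vec (col (1\<^sub>m m :: 'a mat) j)"
      then have i: "i < m" by simp
      have "?v $ i = 0" using zero i by simp
      then show "col (B * A) j $ i = col (1\<^sub>m m) j $ i" using i j A B by simp
    qed (use B in auto)
  qed (use A B in auto)
  have "(of_nat n :: 'a) = of_nat m"
    using mat_trace_mult_commute[OF A B] unfolding AB BA mat_trace_one .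
  then have "n = m" by simp
  then show ?thesis using that B AB BA by blast
qed

lemma subspace_module_vec_iff:
  fixes W :: "'a :: field vec set"
  shows "subspace class_ring W (module_vec TYPE('a) d) \<longleftrightarrow>
     W \<subseteq> carrier_vec d \<and> 0\<^sub>v d \<in> W \<and> (\<forall>v\<in>W. \<forall>w\<in>W. v + w \<in> W) \<and> (\<forall>c. \<forall>v\<in>W. c \<cdot>\<^sub>v v \<in> W)"
proof -
  interpret vec_space "TYPE('a)" d .
  have "vectorspace class_ring (module_vec TYPE('a) d)" "module class_ring (module_vec TYPE('a) d)"
    by unfold_locales
  then show ?thesis
    unfolding subspace_def submodule_def by (auto simp: module_vec_simps)
qed

lemma subspace_mat_kernel:
  fixes T :: "'a :: field mat"
  assumes "T \<in> carrier_mat n m"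
  shows "subspace class_ring {v \<in> carrier_vec m. T *\<^sub>v v = 0\<^sub>v n} (module_vec TYPE('a) m)"
  using assms by (auto simp: subspace_module_vec_iff mult_add_distrib_mat_vec mult_mat_vec)

lemma subspace_mat_range:
  fixes T :: "'a :: field mat"
  assumes T: "T \<in> carrier_mat n m"
  shows "subspace class_ring ((*\<^sub>v) T ` carrier_vec m) (module_vec TYPE('a) n)"
proof -
  have "T *\<^sub>v v + T *\<^sub>v w \<in> (*\<^sub>v) T ` carrier_vec m" if "v \<in> carrier_vec m" "w \<in> carrier_vec m" for v w
    using that by (auto simp flip: mult_add_distrib_mat_vec[OF T])
  moreover have "c \<cdot>\<^sub>v (T *\<^sub>v v) \<in> (*\<^sub>v) T ` carrier_vec m" if "v \<in> carrier_vec m" for c v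
    using that by (auto simp flip: mult_mat_vec[OF T])
  moreover have "T *\<^sub>v 0\<^sub>v m = 0\<^sub>v n" using T by (intro eq_vecI) auto
  then have "0\<^sub>v n \<in> (*\<^sub>v) T ` carrier_vec m" by (metis imageI zero_carrier_vec)
  ultimately show ?thesis
    using T by (auto simp: subspace_module_vec_iff)
qed

lemma representation_carrier:
  assumes "group_representation \<Gamma> d \<rho>" "g \<in> carrier \<Gamma>"
  shows "\<rho> g \<in> carrier_mat d d"
  using assms by (auto simp: group_representation_def hom_def units_of_def Units_def ring_mat_simps)

lemma representation_mult:
  assumes "group_representation \<Gamma> d \<rho>" "g \<in> carrier \<Gamma>" "h \<in> carrier \<Gamma>"
  shows "\<rho> (g \<otimes>\<^bsub>\<Gamma>\<^esub> h) = \<rho> g * \<rho> h"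
  using assms by (auto simp: group_representation_def hom_def units_of_def ring_mat_simps)

lemma representation_mult_index:
  assumes "group_representation \<Gamma> d \<rho>" "g \<in> carrier \<Gamma>" "h \<in> carrier \<Gamma>" "a < d" "b < d"
  shows "\<rho> (g \<otimes>\<^bsub>\<Gamma>\<^esub> h) $$ (a, b) = (\<Sum>c<d. \<rho> g $$ (a, c) * \<rho> h $$ (c, b))"
  unfolding representation_mult[OF assms(1-3)] using assms
  by (intro index_mult_mat_sum) (auto intro: representation_carrier)

lemma irreducible_imp_representation: "irreducible_representation \<Gamma> d \<rho> \<Longrightarrow> group_representation \<Gamma> d \<rho>"
  by (simp add: irreducible_representation_def)

lemma all_irreducible_imp_representation:
  "all_irreducible_representations \<Gamma> k f \<rho> \<Longrightarrow> i \<in> {1..k} \<Longrightarrow> group_representation \<Gamma> (f i) (\<rho> i)"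
  by (simp add: all_irreducible_representations_def irreducible_representation_def)

lemma irreducible_invariant_subspace:
  assumes "irreducible_representation \<Gamma> d \<rho>" "subspace class_ring W (module_vec TYPE(complex) d)"
    "\<And>g w. g \<in> carrier \<Gamma> \<Longrightarrow> w \<in> W \<Longrightarrow> \<rho> g *\<^sub>v w \<in> W"
  shows "W = {0\<^sub>v d} \<or> W = carrier_vec d"
  using assms unfolding irreducible_representation_def by blast

definition intertwines ::
  "('g, 'b) monoid_scheme \<Rightarrow> nat \<Rightarrow> ('g \<Rightarrow> complex mat) \<Rightarrow> nat \<Rightarrow> ('g \<Rightarrow> complex mat) \<Rightarrow> complex mat \<Rightarrow> bool"
where
  "intertwines \<Gamma> d \<rho> d' \<sigma> T \<longleftrightarrow> T \<in> carrier_mat d d' \<and> (\<forall>g\<in>carrier \<Gamma>. T * \<sigma> g = \<rho> g * T)"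

lemma intertwines_mult_vec:
  assumes "intertwines \<Gamma> d \<rho> d' \<sigma> T" "group_representation \<Gamma> d \<rho>" "group_representation \<Gamma> d' \<sigma>"
    and "g \<in> carrier \<Gamma>" "v \<in> carrier_vec d'"
  shows "T *\<^sub>v (\<sigma> g *\<^sub>v v) = \<rho> g *\<^sub>v (T *\<^sub>v v)"
  using assms representation_carrier unfolding intertwines_def by (metis assoc_mult_mat_vec)

lemma intertwiner_zero_or_injective:
  assumes \<rho>: "group_representation \<Gamma> d \<rho>" and \<sigma>: "irreducible_representation \<Gamma> d' \<sigma>"
    and T: "intertwines \<Gamma> d \<rho> d' \<sigma> T"
  shows "T = 0\<^sub>m d d' \<or> {v \<in> carrier_vec d'. T *\<^sub>v v = 0\<^sub>v d} = {0\<^sub>v d'}"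
proof -
  have Tc: "T \<in> carrier_mat d d'" using T by (simp add: intertwines_def)
  let ?K = "{v \<in> carrier_vec d'. T *\<^sub>v v = 0\<^sub>v d}"
  note \<sigma>' = irreducible_imp_representation[OF \<sigma>]
  have "\<sigma> g *\<^sub>v v \<in> ?K" if g: "g \<in> carrier \<Gamma>" and v: "v \<in> ?K" for g v
  proof -
    have "\<rho> g *\<^sub>v 0\<^sub>v d = 0\<^sub>v d"
      using representation_carrier[OF \<rho> g] by (intro eq_vecI) auto
    then show ?thesis
      using intertwines_mult_vec[OF T \<rho> \<sigma>' g, of v] v representation_carrier[OF \<sigma>' g] by simp
  qed
  with subspace_mat_kernel[OF Tc] have "?K = {0\<^sub>v d'} \<or> ?K = carrier_vec d'"
    by (rule irreducible_invariant_subspace[OF \<sigma>])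
  moreover have "T = 0\<^sub>m d d'" if "?K = carrier_vec d'"
  proof (rule mat_col_eqI)
    fix j assume "j < dim_col (0\<^sub>m d d' :: complex mat)"
    moreover have "unit_vec d' j \<in> ?K" unfolding that by simp
    ultimately show "col T j = col (0\<^sub>m d d') j"
      by (simp add: mult_mat_vec_unit_vec[OF Tc])
  qed (use Tc in auto)
  ultimately show ?thesis by blast
qed

lemma intertwiner_zero_or_surjective:
  assumes \<rho>: "irreducible_representation \<Gamma> d \<rho>" and \<sigma>: "group_representation \<Gamma> d' \<sigma>"
    and T: "intertwines \<Gamma> d \<rho> d' \<sigma> T"
  shows "T = 0\<^sub>m d d' \<or> (*\<^sub>v) T ` carrier_vec d' = carrier_vec d"
proof -
  have Tc: "T \<in> carrier_mat d d'" using T by (simp add: intertwines_def)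
  let ?R = "(*\<^sub>v) T ` carrier_vec d'"
  note \<rho>' = irreducible_imp_representation[OF \<rho>]
  have "\<rho> g *\<^sub>v w \<in> ?R" if g: "g \<in> carrier \<Gamma>" and w: "w \<in> ?R" for g w
    using w representation_carrier[OF \<sigma> g] by (auto simp flip: intertwines_mult_vec[OF T \<rho>' \<sigma> g])
  with subspace_mat_range[OF Tc] have "?R = {0\<^sub>v d} \<or> ?R = carrier_vec d"
    by (rule irreducible_invariant_subspace[OF \<rho>])
  moreover have "T = 0\<^sub>m d d'" if "?R = {0\<^sub>v d}"
  proof (rule mat_col_eqI)
    fix j assume "j < dim_col (0\<^sub>m d d' :: complex mat)"
    moreover have "T *\<^sub>v unit_vec d' j \<in> ?R" by simp
    ultimately show "col T j = col (0\<^sub>m d d') j"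
      unfolding that by (simp add: mult_mat_vec_unit_vec[OF Tc])
  qed (use Tc in auto)
  ultimately show ?thesis by blast
qed

lemma intertwiner_inequivalent_eq_zero:
  assumes \<rho>: "irreducible_representation \<Gamma> d \<rho>" and \<sigma>: "irreducible_representation \<Gamma> d' \<sigma>"
    and inequiv: "\<not> equivalent_representations \<Gamma> d' \<sigma> d \<rho>" and T: "intertwines \<Gamma> d \<rho> d' \<sigma> T"
  shows "T = 0\<^sub>m d d'"
proof (rule ccontr)
  assume nonzero: "T \<noteq> 0\<^sub>m d d'"
  have Tc: "T \<in> carrier_mat d d'" using T by (simp add: intertwines_def)
  have "v = 0\<^sub>v d'" if "v \<in> carrier_vec d'" "T *\<^sub>v v = 0\<^sub>v d" for v
    using intertwiner_zero_or_injective[OF irreducible_imp_representation[OF \<rho>] \<sigma> T] nonzero that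
    by blast
  moreover have "\<exists>v\<in>carrier_vec d'. T *\<^sub>v v = w" if "w \<in> carrier_vec d" for w
    using intertwiner_zero_or_surjective[OF \<rho> irreducible_imp_representation[OF \<sigma>] T] nonzero that
    by (metis imageE)
  ultimately obtain S where S: "d = d'" "S \<in> carrier_mat d' d" "T * S = 1\<^sub>m d" "S * T = 1\<^sub>m d'"
    by (rule bijective_mat_invertible[OF Tc])
  then have "T \<in> Units (ring_mat TYPE(complex) d' ())"
    using Tc by (auto simp: Units_def ring_mat_simps)
  with inequiv T S(1) show False
    by (auto simp: equivalent_representations_def intertwines_def)
qed

lemma self_intertwiner_scalar:
  assumes \<rho>: "irreducible_representation \<Gamma> d \<rho>" and T: "intertwines \<Gamma> d \<rho> d \<rho> T"
  obtains c where "T = c \<cdot>\<^sub>m 1\<^sub>m d"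
proof -
  note \<rho>' = irreducible_imp_representation[OF \<rho>]
  have Tc: "T \<in> carrier_mat d d" using T by (simp add: intertwines_def)
  have "d > 0" using \<rho> by (simp add: irreducible_representation_def)
  then obtain c where "eigenvalue T c"
    using spectrum_non_empty[OF Tc] by (auto simp: spectrum_def)
  then obtain v where v: "v \<in> carrier_vec d" "v \<noteq> 0\<^sub>v d" "T *\<^sub>v v = c \<cdot>\<^sub>v v"
    using Tc by (auto simp: eigenvalue_def eigenvector_def)
  let ?S = "T - c \<cdot>\<^sub>m 1\<^sub>m d"
  have "intertwines \<Gamma> d \<rho> d \<rho> ?S"
    unfolding intertwines_def
  proof (intro conjI ballI)
    fix g assume g: "g \<in> carrier \<Gamma>"
    have \<rho>g: "\<rho> g \<in> carrier_mat d d" using representation_carrier[OF \<rho>' g] .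
    have "?S * \<rho> g = T * \<rho> g - c \<cdot>\<^sub>m \<rho> g"
      using Tc \<rho>g by (subst minus_mult_distrib_mat[OF Tc _ \<rho>g]) auto
    also have "\<dots> = \<rho> g * T - \<rho> g * (c \<cdot>\<^sub>m 1\<^sub>m d)"
      using T g \<rho>g by (simp add: intertwines_def mult_smult_distrib[OF \<rho>g one_carrier_mat])
    also have "\<dots> = \<rho> g * ?S"
      using Tc \<rho>g by (subst mult_minus_distrib_mat[OF \<rho>g Tc]) auto
    finally show "?S * \<rho> g = \<rho> g * ?S" .
  qed (use Tc in auto)
  moreover have "(c \<cdot>\<^sub>m 1\<^sub>m d) *\<^sub>v v = c \<cdot>\<^sub>v v"
    using v(1) by (intro eq_vecI) auto
  then have "?S *\<^sub>v v = 0\<^sub>v d"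
    using Tc v by (simp add: minus_mult_distrib_mat_vec[of _ d d])
  ultimately have "?S = 0\<^sub>m d d"
    using intertwiner_zero_or_injective[OF \<rho>' \<rho>, of ?S] v(1,2) by blast
  have "T = c \<cdot>\<^sub>m 1\<^sub>m d"
  proof (rule eq_matI)
    fix i j assume ij: "i < dim_row (c \<cdot>\<^sub>m 1\<^sub>m d)" "j < dim_col (c \<cdot>\<^sub>m 1\<^sub>m d)"
    then have "?S $$ (i, j) = 0" using \<open>?S = 0\<^sub>m d d\<close> by simp
    then show "T $$ (i, j) = (c \<cdot>\<^sub>m 1\<^sub>m d) $$ (i, j)" using ij Tc by simp
  qed (use Tc in auto)
  then show ?thesis by (rule that)
qed

context group
begin

lemma representation_one:
  assumes "group_representation G d \<rho>"
  shows "\<rho> \<one> = 1\<^sub>m d"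
proof -
  have "\<rho> \<one> \<in> Units (ring_mat TYPE(complex) d ())"
    using assms by (auto simp: group_representation_def hom_def units_of_def)
  then obtain P where P: "P \<in> carrier_mat d d" "P * \<rho> \<one> = 1\<^sub>m d"
    by (auto simp: Units_def ring_mat_simps)
  have c: "\<rho> \<one> \<in> carrier_mat d d" using representation_carrier[OF assms] by auto
  have "\<rho> \<one> = P * \<rho> \<one> * \<rho> \<one>" unfolding P(2) using c by simp
  also have "\<dots> = P * (\<rho> \<one> * \<rho> \<one>)" by (rule assoc_mult_mat[OF P(1) c c])
  also have "\<dots> = 1\<^sub>m d" using representation_mult[OF assms one_closed one_closed] P by simp
  finally show ?thesis .
qed

lemma representationI:
  assumes carrier: "\<And>g. g \<in> carrier G \<Longrightarrow> \<rho> g \<in> carrier_mat d d"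
    and one: "\<rho> \<one> = 1\<^sub>m d"
    and mult: "\<And>g h. g \<in> carrier G \<Longrightarrow> h \<in> carrier G \<Longrightarrow> \<rho> (g \<otimes> h) = \<rho> g * \<rho> h"
  shows "group_representation G d \<rho>"
  unfolding group_representation_def
proof (rule homI)
  fix g assume g: "g \<in> carrier G"
  have "\<rho> g * \<rho> (inv g) = 1\<^sub>m d" "\<rho> (inv g) * \<rho> g = 1\<^sub>m d"
    using g by (simp_all add: one flip: mult)
  with g show "\<rho> g \<in> carrier (units_of (ring_mat TYPE(complex) d ()))"
    by (auto simp: units_of_def Units_def ring_mat_simps carrier)
qed (simp add: mult units_of_def ring_mat_simps)

lemma averaged_mat_intertwines:
  assumes \<rho>: "group_representation G d \<rho>" and \<sigma>: "group_representation G d' \<sigma>"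
    and bc: "b < d" "c < d'"
  shows "intertwines G d \<rho> d' \<sigma> (mat d d' (\<lambda>(a, e). \<Sum>g\<in>carrier G. \<rho> g $$ (a, b) * \<sigma> (inv g) $$ (c, e)))"
    (is "intertwines _ _ _ _ _ ?T")
  unfolding intertwines_def
proof (intro conjI ballI eq_matI)
  fix h assume h: "h \<in> carrier G"
  have T: "?T \<in> carrier_mat d d'" by simp
  have \<rho>h: "\<rho> h \<in> carrier_mat d d" and \<sigma>h: "\<sigma> h \<in> carrier_mat d' d'"
    using \<rho> \<sigma> h by (auto intro: representation_carrier)
  show "dim_row (?T * \<sigma> h) = dim_row (\<rho> h * ?T)" "dim_col (?T * \<sigma> h) = dim_col (\<rho> h * ?T)"
    using \<rho>h \<sigma>h by auto
  fix a e assume "a < dim_row (\<rho> h * ?T)" "e < dim_col (\<rho> h * ?T)"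
  then have ae: "a < d" "e < d'" using \<rho>h by auto
  have "(?T * \<sigma> h) $$ (a, e) =
      (\<Sum>x<d'. (\<Sum>g\<in>carrier G. \<rho> g $$ (a, b) * \<sigma> (inv g) $$ (c, x)) * \<sigma> h $$ (x, e))"
    unfolding index_mult_mat_sum[OF T \<sigma>h ae] using ae by simp
  also have "\<dots> = (\<Sum>g\<in>carrier G. \<rho> g $$ (a, b) * (\<Sum>x<d'. \<sigma> (inv g) $$ (c, x) * \<sigma> h $$ (x, e)))"
    unfolding sum_distrib_left sum_distrib_right by (subst sum.swap) (simp add: mult.assoc)
  also have "\<dots> = (\<Sum>g\<in>carrier G. \<rho> g $$ (a, b) * \<sigma> (inv g \<otimes> h) $$ (c, e))"
    using bc ae h by (simp add: representation_mult_index[OF \<sigma>])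
  also have "\<dots> = (\<Sum>g\<in>carrier G. \<rho> (h \<otimes> g) $$ (a, b) * \<sigma> (inv (h \<otimes> g) \<otimes> h) $$ (c, e))"
    by (rule sum.reindex_bij_betw[symmetric]) (simp add: bij_betw_def inj_on_cmult surj_const_mult h)
  also have "\<dots> = (\<Sum>g\<in>carrier G. (\<Sum>x<d. \<rho> h $$ (a, x) * \<rho> g $$ (x, b)) * \<sigma> (inv g) $$ (c, e))"
    using bc ae h
    by (auto intro!: sum.cong simp: inv_mult_group m_assoc representation_mult_index[OF \<rho>])
  also have "\<dots> = (\<Sum>x<d. \<rho> h $$ (a, x) * (\<Sum>g\<in>carrier G. \<rho> g $$ (x, b) * \<sigma> (inv g) $$ (c, e)))"
    unfolding sum_distrib_left sum_distrib_right by (subst sum.swap) (simp add: mult.assoc)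
  also have "\<dots> = (\<rho> h * ?T) $$ (a, e)"
    unfolding index_mult_mat_sum[OF \<rho>h T ae] using ae by simp
  finally show "(?T * \<sigma> h) $$ (a, e) = (\<rho> h * ?T) $$ (a, e)" .
qed simp

lemma schur_orthogonality_inequivalent:
  assumes \<rho>: "irreducible_representation G d \<rho>" and \<sigma>: "irreducible_representation G d' \<sigma>"
    and inequiv: "\<not> equivalent_representations G d' \<sigma> d \<rho>"
    and "a < d" "b < d" "c < d'" "e < d'"
  shows "(\<Sum>g\<in>carrier G. \<rho> g $$ (a, b) * \<sigma> (inv g) $$ (c, e)) = 0"
proof -
  define T where "T = mat d d' (\<lambda>(a, e). \<Sum>g\<in>carrier G. \<rho> g $$ (a, b) * \<sigma> (inv g) $$ (c, e))"
  have "intertwines G d \<rho> d' \<sigma> T"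
    unfolding T_def using assms by (intro averaged_mat_intertwines irreducible_imp_representation)
  then have "T = 0\<^sub>m d d'"
    by (rule intertwiner_inequivalent_eq_zero[OF \<rho> \<sigma> inequiv])
  then have "T $$ (a, e) = 0" using assms by simp
  then show ?thesis using assms by (simp add: T_def)
qed

lemma schur_orthogonality:
  assumes \<rho>: "irreducible_representation G d \<rho>"
    and "a < d" "b < d" "c < d" "e < d"
  shows "(\<Sum>g\<in>carrier G. \<rho> g $$ (a, b) * \<rho> (inv g) $$ (c, e)) =
           of_nat (Coset.order G) / of_nat d * kdelta a e * kdelta b c"
proof -
  have rep: "group_representation G d \<rho>" and d: "d > 0"
    using \<rho> by (auto simp: irreducible_representation_def)
  define T where "T = mat d d (\<lambda>(a, e). \<Sum>g\<in>carrier G. \<rho> g $$ (a, b) * \<rho> (inv g) $$ (c, e))"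
  have "intertwines G d \<rho> d \<rho> T"
    unfolding T_def using assms by (intro averaged_mat_intertwines rep)
  then obtain k where k: "T = k \<cdot>\<^sub>m 1\<^sub>m d"
    by (rule self_intertwiner_scalar[OF \<rho>])
  have "of_nat d * k = mat_trace T" by (simp add: k mat_trace_def)
  also have "\<dots> = (\<Sum>g\<in>carrier G. \<Sum>x<d. \<rho> (inv g) $$ (c, x) * \<rho> g $$ (x, b))"
    unfolding mat_trace_def by (simp add: T_def) (subst sum.swap, simp add: mult.commute)
  also have "\<dots> = (\<Sum>g\<in>carrier G. \<rho> \<one> $$ (c, b))"
    using assms by (intro sum.cong refl) (simp flip: representation_mult_index[OF rep])
  also have "\<dots> = of_nat (Coset.order G) * kdelta b c"
    using assms by (simp add: representation_one[OF rep] Coset.order_def kdelta_def)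
  finally have "k = of_nat (Coset.order G) / of_nat d * kdelta b c" using d by (simp add: field_simps)
  moreover have "T $$ (a, e) = k * kdelta a e" using assms by (simp add: k kdelta_def)
  ultimately show ?thesis using assms by (simp add: T_def)
qed

lemma mat_trace_representation:
  assumes "group_representation G d \<rho>" "g \<in> carrier G"
  shows "mat_trace (\<rho> g) = (\<Sum>a<d. \<rho> g $$ (a, a))"
  using representation_carrier[OF assms] by (simp add: mat_trace_def)

lemma character_orthogonality:
  assumes irr: "all_irreducible_representations G k f \<rho>" and ij: "i \<in> {1..k}" "j \<in> {1..k}"
  shows "(\<Sum>g\<in>carrier G. mat_trace (\<rho> i g) * mat_trace (\<rho> j (inv g))) =
      of_nat (Coset.order G) * kdelta i j"
proof -
  have irr_i: "irreducible_representation G (f i) (\<rho> i)"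
    and irr_j: "irreducible_representation G (f j) (\<rho> j)"
    using irr ij by (auto simp: all_irreducible_representations_def)
  have "(\<Sum>g\<in>carrier G. mat_trace (\<rho> i g) * mat_trace (\<rho> j (inv g))) =
      (\<Sum>g\<in>carrier G. \<Sum>a<f i. \<Sum>c<f j. \<rho> i g $$ (a, a) * \<rho> j (inv g) $$ (c, c))"
    using irr_i irr_j
    by (simp add: mat_trace_representation[OF irreducible_imp_representation] sum_product)
  also have "\<dots> = (\<Sum>a<f i. \<Sum>c<f j. \<Sum>g\<in>carrier G. \<rho> i g $$ (a, a) * \<rho> j (inv g) $$ (c, c))"
    by (subst sum.swap) (intro sum.cong refl sum.swap)
  also have "\<dots> = of_nat (Coset.order G) * kdelta i j"
  proof (cases "i = j")
    case True
    have "f i > 0" using irr_i by (simp add: irreducible_representation_def)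
    have "(\<Sum>a<f i. \<Sum>c<f i. \<Sum>g\<in>carrier G. \<rho> i g $$ (a, a) * \<rho> i (inv g) $$ (c, c)) =
        (\<Sum>a<f i. \<Sum>c<f i. of_nat (Coset.order G) / of_nat (f i) * kdelta a c * kdelta a c)"
      by (simp add: schur_orthogonality[OF irr_i])
    also have "\<dots> = of_nat (Coset.order G)" using \<open>f i > 0\<close> by (simp del: times_divide_eq_left)
    finally show ?thesis using True by simp
  next
    case False
    then have "\<not> equivalent_representations G (f j) (\<rho> j) (f i) (\<rho> i)"
      using irr ij by (auto simp: all_irreducible_representations_def)
    then show ?thesis
      using False by (simp add: schur_orthogonality_inequivalent[OF irr_i irr_j] kdelta_def)
  qed
  finally show ?thesis .
qed

end

section \<open>Composition factors of a representation\<close>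

lemma (in vec_space) maximal_lin_indpt_spans:
  assumes W: "W \<subseteq> carrier_vec n" and max: "maximal B (\<lambda>A. A \<subseteq> W \<and> lin_indpt A)"
  shows "W \<subseteq> span B"
proof
  fix w assume w: "w \<in> W"
  have B: "B \<subseteq> W" "lin_indpt B" using max by (simp_all add: maximal_def)
  then have Bc: "B \<subseteq> carrier_vec n" using W by blast
  show "w \<in> span B"
  proof (rule ccontr)
    assume out: "w \<notin> span B"
    then have "w \<notin> B" using in_own_span[of B] Bc by auto
    moreover have "lin_indpt (insert w B)"
      using lin_dep_iff_in_span[of B w] B Bc w W out \<open>w \<notin> B\<close> by auto
    ultimately have "insert w B = B"
      using max B(1) w unfolding maximal_def by (metis insert_subset subset_insertI)
    with \<open>w \<notin> B\<close> show False by auto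
  qed
qed

lemma (in vec_space) subspace_basis_extension:
  assumes W: "W \<subseteq> carrier_vec n"
  obtains B C where "B \<subseteq> W" "W \<subseteq> span B" "B \<subseteq> C" "finite C" "basis C"
proof -
  have bound: "finite A \<and> card A \<le> n" if "A \<subseteq> carrier_vec n" "lin_indpt A" for A
    using li_le_dim[OF fin_dim] that by (simp add: dim_is_n)
  have "\<exists>B. finite B \<and> maximal B (\<lambda>A. A \<subseteq> W \<and> lin_indpt A)"
  proof (rule maximal_exists)
    show "finite A \<and> card A \<le> n" if "A \<subseteq> W \<and> lin_indpt A" for A
      using that W by (intro bound) blast+
    show "{} \<subseteq> W \<and> lin_indpt {}" by (simp add: lin_dep_def)
  qed
  then obtain B where max: "maximal B (\<lambda>A. A \<subseteq> W \<and> lin_indpt A)" by auto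
  then have B: "B \<subseteq> W" "lin_indpt B" by (simp_all add: maximal_def)
  have "\<exists>C. finite C \<and> maximal C (\<lambda>A. B \<subseteq> A \<and> A \<subseteq> carrier_vec n \<and> lin_indpt A)"
  proof (rule maximal_exists)
    show "finite A \<and> card A \<le> n" if "B \<subseteq> A \<and> A \<subseteq> carrier_vec n \<and> lin_indpt A" for A
      using that by (intro bound) blast+
    show "B \<subseteq> B \<and> B \<subseteq> carrier_vec n \<and> lin_indpt B" using B W by blast
  qed
  then obtain C where C: "finite C" "maximal C (\<lambda>A. B \<subseteq> A \<and> A \<subseteq> carrier_vec n \<and> lin_indpt A)" by auto
  then have BC: "B \<subseteq> C" by (simp add: maximal_def)
  have "maximal C (\<lambda>A. A \<subseteq> carrier_vec n \<and> lin_indpt A)"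
    unfolding maximal_def
  proof (intro conjI allI impI)
    show "A = C" if "C \<subseteq> A \<and> A \<subseteq> carrier_vec n \<and> lin_indpt A" for A
      using C(2) that BC unfolding maximal_def by (metis subset_trans)
  qed (use C(2) in \<open>simp_all add: maximal_def\<close>)
  then show ?thesis
    using that B(1) maximal_lin_indpt_spans[OF W max] BC C(1) max_li_is_basis by simp
qed

lemma (in vec_space) basis_mat_of_cols_invertible:
  assumes xs: "distinct xs" "basis (set xs)"
  obtains Q' where "length xs = n" "Q' \<in> carrier_mat n n"
    "mat_of_cols n xs * Q' = 1\<^sub>m n" "Q' * mat_of_cols n xs = 1\<^sub>m n"
proof -
  have xs_carrier: "set xs \<subseteq> carrier_vec n" and indpt: "lin_indpt (set xs)"
    using xs(2) by (simp_all add: basis_def)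
  have len: "length xs = n"
    using dim_basis[OF finite_set xs(2)] distinct_card[OF xs(1)] by (simp add: dim_is_n)
  have Q: "mat_of_cols n xs \<in> carrier_mat n n" using len by (intro carrier_matI) simp_all
  have "cols (mat_of_cols n xs) = xs" using xs_carrier by (intro cols_mat_of_cols) auto
  then have "rank (mat_of_cols n xs) = n"
    using xs(1) indpt by (intro lin_indpt_full_rank[OF Q]) simp_all
  then have "det (mat_of_cols n xs) \<noteq> 0" by (simp add: det_rank_iff[OF Q])
  then show ?thesis
    using det_non_zero_imp_unit[OF Q, of "()"] that[OF len] by (auto simp: Units_def ring_mat_simps)
qed

lemma (in vec_space) lincomb_coordinates_mat_of_cols:
  assumes xs: "distinct xs" "set xs \<subseteq> carrier_vec n" "length xs = n"
    and Q': "Q' \<in> carrier_mat n n" "Q' * mat_of_cols n xs = 1\<^sub>m n"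
    and B: "B \<subseteq> set xs" and i: "i < n"
  shows "(Q' *\<^sub>v lincomb a B) $ i = (if xs ! i \<in> B then a (xs ! i) else 0)"
proof -
  define b where "b x = (if x \<in> B then a x else 0)" for x
  have Q: "mat_of_cols n xs \<in> carrier_mat n n" using xs(3) by (intro carrier_matI) simp_all
  have fin: "finite B" and Bc: "B \<subseteq> carrier_vec n" using B xs(2) finite_subset by auto
  have "lincomb a B = lincomb b (set xs)"
  proof (rule eq_vecI)
    fix l assume "l < dim_vec (lincomb b (set xs))"
    then have l: "l < n" using lincomb_dim[OF finite_set xs(2)] by simp
    have "(\<Sum>x\<in>set xs. b x * x $ l) = (\<Sum>x\<in>B. a x * x $ l)"
      using B by (intro sum.mono_neutral_cong_right) (auto simp: b_def)
    then show "lincomb a B $ l = lincomb b (set xs) $ l"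
      by (simp add: lincomb_index[OF l xs(2)] lincomb_index[OF l Bc])
  qed (simp add: lincomb_dim[OF fin Bc] lincomb_dim[OF finite_set xs(2)])
  also have "cols (mat_of_cols n xs) = xs" using xs(2) by (intro cols_mat_of_cols) auto
  then have "lincomb b (set xs) = mat_of_cols n xs *\<^sub>v vec n (\<lambda>i. b (col (mat_of_cols n xs) i))"
    using mat_mult_eq_lincomb[OF Q, of b] xs(1) by simp
  also have "Q' *\<^sub>v \<dots> = vec n (\<lambda>i. b (col (mat_of_cols n xs) i))"
    using Q Q' by (simp flip: assoc_mult_mat_vec[OF Q'(1) Q])
  finally show ?thesis
    using i xs(2,3) by (simp add: b_def col_mat_of_cols nth_mem subset_iff)
qed

lemma subspace_adapted_basis:
  fixes W :: "'a :: field vec set"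
  assumes W: "subspace class_ring W (module_vec TYPE('a) d)"
    and proper: "W \<noteq> {0\<^sub>v d}" "W \<noteq> carrier_vec d"
  obtains r Q Q' where "0 < r" "r < d"
    "Q \<in> carrier_mat d d" "Q' \<in> carrier_mat d d" "Q * Q' = 1\<^sub>m d" "Q' * Q = 1\<^sub>m d"
    "\<And>j. j < r \<Longrightarrow> col Q j \<in> W" "\<And>w i. w \<in> W \<Longrightarrow> r \<le> i \<Longrightarrow> i < d \<Longrightarrow> (Q' *\<^sub>v w) $ i = 0"
proof -
  interpret vec_space "TYPE('a)" d .
  have Wc: "W \<subseteq> carrier_vec d" using W by (simp add: subspace_module_vec_iff)
  obtain B C where B: "B \<subseteq> W" "W \<subseteq> span B" and BC: "B \<subseteq> C" and C: "finite C" "basis C"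
    using subspace_basis_extension[OF Wc] by metis
  have Cc: "C \<subseteq> carrier_vec d" and Bc: "B \<subseteq> carrier_vec d" using C(2) B(1) Wc by (auto simp: basis_def)
  have finB: "finite B" and finCB: "finite (C - B)" using BC C(1) finite_subset by auto
  obtain bs cs where bs: "distinct bs" "set bs = B" and cs: "distinct cs" "set cs = C - B"
    using finite_distinct_list[OF finB] finite_distinct_list[OF finCB] by metis
  define Q where "Q = mat_of_cols d (bs @ cs)"
  have xs: "set (bs @ cs) = C" "distinct (bs @ cs)" using bs cs BC by auto
  obtain Q' where len: "length (bs @ cs) = d"
    and Q': "Q' \<in> carrier_mat d d" "Q * Q' = 1\<^sub>m d" "Q' * Q = 1\<^sub>m d"
    using basis_mat_of_cols_invertible[of "bs @ cs"] xs C(2) unfolding Q_def by metis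
  have Q: "Q \<in> carrier_mat d d" unfolding Q_def using len by (intro carrier_matI) simp_all
  have coords: "(Q' *\<^sub>v w) $ i = 0" if w: "w \<in> W" and i: "length bs \<le> i" "i < d" for w i
  proof -
    obtain a where "w = lincomb a B" using w B(2) finite_span[OF finB] Bc by auto
    moreover have "(bs @ cs) ! i \<in> C - B"
      using i len cs(2) nth_mem[of "i - length bs" cs] by (simp add: nth_append)
    moreover have "(Q' *\<^sub>v lincomb a B) $ i = (if (bs @ cs) ! i \<in> B then a ((bs @ cs) ! i) else 0)" for a
      using xs Cc BC Q'(3) unfolding Q_def
      by (intro lincomb_coordinates_mat_of_cols[OF xs(2) _ len Q'(1) _ _ i(2)]) simp_all
    ultimately show ?thesis by simp
  qed
  have cols: "col Q j \<in> W" if "j < length bs" for j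
    using that len xs(1) Cc B(1) bs(2) nth_mem[OF that] unfolding Q_def
    by (subst col_mat_of_cols) (auto simp: nth_append)
  have span: "span B = W"
    using span_is_subset[OF B(1)] B(2) W by (simp add: subspace_def subset_antisym)
  have "bs \<noteq> []" using proper(1) span bs span_empty by auto
  moreover have "cs \<noteq> []" using proper(2) span xs bs C(2) by (auto simp: basis_def)
  ultimately have "0 < length bs" "length bs < d" using len by auto
  then show ?thesis by (rule that[OF _ _ Q Q' cols coords])
qed

definition extension_representation ::
  "('g, 'b) monoid_scheme \<Rightarrow> nat \<Rightarrow> ('g \<Rightarrow> complex mat) \<Rightarrow> nat \<Rightarrow> ('g \<Rightarrow> complex mat) \<Rightarrow> ('g \<Rightarrow> complex mat) \<Rightarrow> bool"
where
  "extension_representation \<Gamma> r \<sigma> s \<tau> \<pi> \<longleftrightarrow>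
     group_representation \<Gamma> r \<sigma> \<and> group_representation \<Gamma> s \<tau> \<and>
     (\<forall>g\<in>carrier \<Gamma>. \<exists>N\<in>carrier_mat r s. \<pi> g = four_block_mat (\<sigma> g) N (0\<^sub>m s r) (\<tau> g))"

lemma (in group) representation_conjugate:
  assumes \<pi>: "group_representation G d \<pi>" and Q: "Q \<in> carrier_mat d d" "Q' \<in> carrier_mat d d"
    and inverse: "Q * Q' = 1\<^sub>m d" "Q' * Q = 1\<^sub>m d"
  shows "group_representation G d (\<lambda>g. Q' * \<pi> g * Q)"
    and "equivalent_representations G d (\<lambda>g. Q' * \<pi> g * Q) d \<pi>"
proof -
  note carrier = representation_carrier[OF \<pi>]
  have intertwine: "Q * (Q' * \<pi> g * Q) = \<pi> g * Q" if "g \<in> carrier G" for g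
  proof -
    have "Q * (Q' * \<pi> g * Q) = (Q * Q') * \<pi> g * Q"
      using Q carrier[OF that] by (simp add: assoc_mult_mat[of _ d d _ d _ d])
    then show ?thesis using carrier[OF that] inverse by simp
  qed
  show "group_representation G d (\<lambda>g. Q' * \<pi> g * Q)"
  proof (rule representationI)
    show "Q' * \<pi> g * Q \<in> carrier_mat d d" if "g \<in> carrier G" for g
      using that Q carrier by (meson mult_carrier_mat)
    show "Q' * \<pi> \<one> * Q = 1\<^sub>m d"
      using Q inverse by (simp add: representation_one[OF \<pi>])
    fix g h assume gh: "g \<in> carrier G" "h \<in> carrier G"
    have "Q' * \<pi> g * Q * (Q' * \<pi> h * Q) = Q' * \<pi> g * (Q * (Q' * \<pi> h * Q))"
      by (rule assoc_mult_mat[of _ d d _ d _ d]) (use Q carrier gh in auto)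
    also have "\<dots> = Q' * \<pi> g * \<pi> h * Q"
      unfolding intertwine[OF gh(2)]
      by (rule assoc_mult_mat[of _ d d _ d _ d, symmetric]) (use Q carrier gh in auto)
    also have "Q' * \<pi> g * \<pi> h = Q' * \<pi> (g \<otimes> h)"
      unfolding representation_mult[OF \<pi> gh]
      by (rule assoc_mult_mat[of _ d d _ d _ d]) (use Q carrier gh in auto)
    finally show "Q' * \<pi> (g \<otimes> h) * Q = Q' * \<pi> g * Q * (Q' * \<pi> h * Q)" by simp
  qed
  have "Q \<in> Units (ring_mat TYPE(complex) d ())"
    using Q inverse by (auto simp: Units_def ring_mat_simps)
  then show "equivalent_representations G d (\<lambda>g. Q' * \<pi> g * Q) d \<pi>"
    unfolding equivalent_representations_def using intertwine by auto
qed

lemma four_block_mat_diagonal_eqD: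
  assumes eq: "four_block_mat A B C D = four_block_mat A' B' C' D'"
    and A: "A \<in> carrier_mat nr1 nc1" "A' \<in> carrier_mat nr1 nc1"
    and D: "D \<in> carrier_mat nr2 nc2" "D' \<in> carrier_mat nr2 nc2"
  shows "A = A'" "D = D'"
proof -
  have eq_index: "four_block_mat A B C D $$ (i, j) = four_block_mat A' B' C' D' $$ (i, j)" for i j
    by (simp only: eq)
  show "A = A'"
  proof (rule eq_matI)
    show "A $$ (i, j) = A' $$ (i, j)" if "i < dim_row A'" "j < dim_col A'" for i j
      using eq_index[of i j] that A D by simp
  qed (use A in auto)
  show "D = D'"
  proof (rule eq_matI)
    show "D $$ (i, j) = D' $$ (i, j)" if "i < dim_row D'" "j < dim_col D'" for i j
      using eq_index[of "nr1 + i" "nc1 + j"] that A D by simp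
  qed (use D in auto)
qed

lemma (in group) extension_representationI:
  assumes \<pi>: "group_representation G (r + s) \<pi>"
    and zero: "\<And>g i j. g \<in> carrier G \<Longrightarrow> r \<le> i \<Longrightarrow> i < r + s \<Longrightarrow> j < r \<Longrightarrow> \<pi> g $$ (i, j) = 0"
  shows "extension_representation G r (\<lambda>g. mat r r (($$) (\<pi> g)))
      s (\<lambda>g. mat s s (\<lambda>(i, j). \<pi> g $$ (r + i, r + j))) \<pi>"
proof -
  define \<sigma> N \<tau> where "\<sigma> g = mat r r (($$) (\<pi> g))" and "N g = mat r s (\<lambda>(i, j). \<pi> g $$ (i, r + j))"
    and "\<tau> g = mat s s (\<lambda>(i, j). \<pi> g $$ (r + i, r + j))" for g
  have carrier: "\<sigma> g \<in> carrier_mat r r" "N g \<in> carrier_mat r s" "\<tau> g \<in> carrier_mat s s" for g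
    by (simp_all add: \<sigma>_def N_def \<tau>_def)
  have blocks: "\<pi> g = four_block_mat (\<sigma> g) (N g) (0\<^sub>m s r) (\<tau> g)" if "g \<in> carrier G" for g
    using representation_carrier[OF \<pi> that] zero[OF that]
    by (intro eq_matI) (auto simp: \<sigma>_def N_def \<tau>_def)
  have "four_block_mat (\<sigma> \<one>) (N \<one>) (0\<^sub>m s r) (\<tau> \<one>) = four_block_mat (1\<^sub>m r) (0\<^sub>m r s) (0\<^sub>m s r) (1\<^sub>m s)"
    using blocks[OF one_closed] representation_one[OF \<pi>] by simp
  note one = four_block_mat_diagonal_eqD[OF this carrier(1) one_carrier_mat carrier(3) one_carrier_mat]
  have mult: "\<sigma> (g \<otimes> h) = \<sigma> g * \<sigma> h" "\<tau> (g \<otimes> h) = \<tau> g * \<tau> h"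
    if gh: "g \<in> carrier G" "h \<in> carrier G" for g h
  proof -
    have "four_block_mat (\<sigma> (g \<otimes> h)) (N (g \<otimes> h)) (0\<^sub>m s r) (\<tau> (g \<otimes> h)) = \<pi> g * \<pi> h"
      using gh by (simp add: representation_mult[OF \<pi>] flip: blocks)
    also have "\<dots> = four_block_mat (\<sigma> g * \<sigma> h) (\<sigma> g * N h + N g * \<tau> h) (0\<^sub>m s r) (\<tau> g * \<tau> h)"
      unfolding blocks[OF gh(1)] blocks[OF gh(2)] using carrier[of g] carrier[of h]
      by (subst mult_four_block_mat[of _ r r _ s _ s]) (auto intro!: cong_four_block_mat)
    finally show "\<sigma> (g \<otimes> h) = \<sigma> g * \<sigma> h" "\<tau> (g \<otimes> h) = \<tau> g * \<tau> h"
      using four_block_mat_diagonal_eqD[of "\<sigma> (g \<otimes> h)" _ _ "\<tau> (g \<otimes> h)" "\<sigma> g * \<sigma> h" _ _ "\<tau> g * \<tau> h"]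
        carrier mult_carrier_mat by metis+
  qed
  have "group_representation G r \<sigma>" "group_representation G s \<tau>"
    by (auto intro!: representationI carrier simp: one mult)
  then show ?thesis
    unfolding extension_representation_def \<sigma>_def[symmetric] \<tau>_def[symmetric] using blocks carrier
    by metis
qed

lemma (in group) reducible_equivalent_extension:
  assumes \<pi>: "group_representation G d \<pi>" and pos: "0 < d" and red: "\<not> irreducible_representation G d \<pi>"
  obtains r s \<sigma> \<tau> \<pi>' where "0 < r" "0 < s" "d = r + s" "extension_representation G r \<sigma> s \<tau> \<pi>'"
    "group_representation G d \<pi>'" "equivalent_representations G d \<pi>' d \<pi>"
proof -
  obtain W where W: "subspace class_ring W (module_vec TYPE(complex) d)"
      "W \<noteq> {0\<^sub>v d}" "W \<noteq> carrier_vec d"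
    and invariant: "\<And>g w. g \<in> carrier G \<Longrightarrow> w \<in> W \<Longrightarrow> \<pi> g *\<^sub>v w \<in> W"
    using \<pi> pos red unfolding irreducible_representation_def by blast
  obtain r Q Q' where r: "0 < r" "r < d" and Q: "Q \<in> carrier_mat d d" "Q' \<in> carrier_mat d d"
      "Q * Q' = 1\<^sub>m d" "Q' * Q = 1\<^sub>m d"
    and cols: "\<And>j. j < r \<Longrightarrow> col Q j \<in> W"
    and coords: "\<And>w i. w \<in> W \<Longrightarrow> r \<le> i \<Longrightarrow> i < d \<Longrightarrow> (Q' *\<^sub>v w) $ i = 0"
    using subspace_adapted_basis[OF W] by metis
  note conj = representation_conjugate[OF \<pi> Q]
  have "(Q' * \<pi> g * Q) $$ (i, j) = 0" if "g \<in> carrier G" "r \<le> i" "i < d" "j < r" for g i j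
  proof -
    have \<pi>g: "\<pi> g \<in> carrier_mat d d" using representation_carrier[OF \<pi> that(1)] .
    have "(Q' * \<pi> g * Q) $$ (i, j) = col (Q' * \<pi> g * Q) j $ i"
      using that r Q \<pi>g by simp
    also have "col (Q' * \<pi> g * Q) j = Q' * \<pi> g *\<^sub>v col Q j"
      by (rule col_mult2[of _ d d _ d]) (use that r Q \<pi>g in auto)
    also have "\<dots> = Q' *\<^sub>v (\<pi> g *\<^sub>v col Q j)"
      by (rule assoc_mult_mat_vec[of _ d d _ d]) (use that r Q \<pi>g in auto)
    also have "\<dots> $ i = 0"
      using that by (intro coords invariant cols)
    finally show ?thesis .
  qed
  then have "extension_representation G r (\<lambda>g. mat r r (($$) (Q' * \<pi> g * Q)))
      (d - r) (\<lambda>g. mat (d - r) (d - r) (\<lambda>(i, j). (Q' * \<pi> g * Q) $$ (r + i, r + j))) (\<lambda>g. Q' * \<pi> g * Q)"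
    using r conj(1) by (intro extension_representationI) auto
  then show ?thesis
    using r conj by (intro that[of r "d - r"]) auto
qed

lemma (in group) representation_induct [consumes 1, case_names zero irreducible equivalent extension]:
  assumes "group_representation G d \<pi>"
    and zero: "\<And>\<pi>. group_representation G 0 \<pi> \<Longrightarrow> P 0 \<pi>"
    and irreducible: "\<And>d \<pi>. irreducible_representation G d \<pi> \<Longrightarrow> P d \<pi>"
    and equivalent: "\<And>d \<pi> \<pi>'. group_representation G d \<pi> \<Longrightarrow> group_representation G d \<pi>' \<Longrightarrow>
      equivalent_representations G d \<pi> d \<pi>' \<Longrightarrow> P d \<pi> \<Longrightarrow> P d \<pi>'"
    and extension: "\<And>r \<sigma> s \<tau> \<pi>. extension_representation G r \<sigma> s \<tau> \<pi> \<Longrightarrow> P r \<sigma> \<Longrightarrow> P s \<tau> \<Longrightarrow> P (r + s) \<pi>"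
  shows "P d \<pi>"
  using assms(1)
proof (induction d arbitrary: \<pi> rule: less_induct)
  case (less d)
  consider "d = 0" | "irreducible_representation G d \<pi>" | "0 < d" "\<not> irreducible_representation G d \<pi>"
    by blast
  then show ?case
  proof cases
    case 3
    then obtain r s \<sigma> \<tau> \<pi>' where rs: "0 < r" "0 < s" "d = r + s"
      and ext: "extension_representation G r \<sigma> s \<tau> \<pi>'"
      and \<pi>': "group_representation G d \<pi>'" "equivalent_representations G d \<pi>' d \<pi>"
      using reducible_equivalent_extension[OF less.prems] by metis
    have "P r \<sigma>" "P s \<tau>"
      using ext rs by (auto simp: extension_representation_def intro!: less.IH)
    then have "P d \<pi>'" unfolding rs(3) by (rule extension[OF ext])
    then show ?thesis by (rule equivalent[OF \<pi>'(1) less.prems \<pi>'(2)])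
  qed (use less.prems in \<open>auto intro: zero irreducible\<close>)
qed

lemma mat_trace_equivalent_representations:
  assumes \<pi>: "group_representation \<Gamma> d \<pi>" and \<pi>': "group_representation \<Gamma> d' \<pi>'"
    and equiv: "equivalent_representations \<Gamma> d \<pi> d' \<pi>'" and g: "g \<in> carrier \<Gamma>"
  shows "mat_trace (\<pi> g) = mat_trace (\<pi>' g)"
proof -
  obtain P P' where d: "d = d'"
    and P: "P \<in> carrier_mat d d" "P' \<in> carrier_mat d d" "P * P' = 1\<^sub>m d" "P' * P = 1\<^sub>m d"
    and intertwine: "P * \<pi> g = \<pi>' g * P"
    using equiv g unfolding equivalent_representations_def by (auto simp: Units_def ring_mat_simps)
  have c: "\<pi> g \<in> carrier_mat d d" "\<pi>' g \<in> carrier_mat d d"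
    using representation_carrier[OF \<pi> g] representation_carrier[OF \<pi>' g] d by simp_all
  have "mat_trace (\<pi> g) = mat_trace (P' * (P * \<pi> g))"
    using P c by (simp flip: assoc_mult_mat[of _ d d _ d _ d])
  also have "\<dots> = mat_trace (P * \<pi> g * P')"
    using P c by (intro mat_trace_mult_commute) auto
  also have "\<dots> = mat_trace (\<pi>' g)"
    unfolding intertwine using P c by (simp add: assoc_mult_mat[of _ d d _ d _ d])
  finally show ?thesis .
qed

lemma lessThan_add: "{..<m + n} = {..<m} \<union> (+) m ` {..<n}" "{..<m} \<inter> (+) m ` {..<n} = {}" for m n :: nat
  by (auto simp: lessThan_atLeast0 image_add_atLeastLessThan)

lemma mat_trace_extension_representation:
  assumes "extension_representation \<Gamma> r \<sigma> s \<tau> \<pi>" "g \<in> carrier \<Gamma>"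
  shows "mat_trace (\<pi> g) = mat_trace (\<sigma> g) + mat_trace (\<tau> g)"
proof -
  obtain N where N: "N \<in> carrier_mat r s" "\<pi> g = four_block_mat (\<sigma> g) N (0\<^sub>m s r) (\<tau> g)"
    using assms unfolding extension_representation_def by blast
  have "\<sigma> g \<in> carrier_mat r r" "\<tau> g \<in> carrier_mat s s"
    using assms by (auto simp: extension_representation_def intro: representation_carrier)
  then show ?thesis
    by (simp add: N(2) mat_trace_def lessThan_add sum.union_disjoint sum.reindex)
qed

definition twisted_det ::
  "('g, 'b) monoid_scheme \<Rightarrow> nat \<Rightarrow> ('g \<Rightarrow> complex mat) \<Rightarrow> 'e set \<Rightarrow> ('g \<Rightarrow> 'e \<Rightarrow> 'e \<Rightarrow> complex) \<Rightarrow> complex"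
where
  "twisted_det \<Gamma> d \<rho> E W =
     det_on ({..<d} \<times> E) (\<lambda>p q. \<Sum>g\<in>carrier \<Gamma>. kron (curry (($$) (\<rho> g))) (W g) p q)"

lemma twisted_det_zero: "twisted_det \<Gamma> 0 \<rho> E W = 1"
  by (simp add: twisted_det_def det_on_def)

lemma mult_on_curry_mat:
  assumes "A \<in> carrier_mat n m" "B \<in> carrier_mat m k" "i < n" "j < k"
  shows "mult_on {..<m} (curry (($$) A)) (curry (($$) B)) i j = (A * B) $$ (i, j)"
  using index_mult_mat_sum[OF assms] by (simp add: mult_on_def)

lemma twisted_det_equivalent:
  assumes fin: "finite E" and \<pi>: "group_representation \<Gamma> d \<pi>" and \<pi>': "group_representation \<Gamma> d' \<pi>'"
    and equiv: "equivalent_representations \<Gamma> d \<pi> d' \<pi>'"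
  shows "twisted_det \<Gamma> d \<pi> E W = twisted_det \<Gamma> d' \<pi>' E W"
proof -
  obtain P P' where d: "d' = d" and P: "P \<in> carrier_mat d d" "P' \<in> carrier_mat d d" "P * P' = 1\<^sub>m d"
    and intertwine: "\<And>g. g \<in> carrier \<Gamma> \<Longrightarrow> P * \<pi> g = \<pi>' g * P"
    using equiv unfolding equivalent_representations_def by (auto simp: Units_def ring_mat_simps)
  let ?X = "{..<d} \<times> E" and ?Q = "kron (curry (($$) P)) kdelta"
    and ?Q' = "kron (curry (($$) P')) kdelta"
  let ?A = "\<lambda>\<pi> p q. \<Sum>g\<in>carrier \<Gamma>. kron (curry (($$) (\<pi> g))) (W g) p q"
  have fin_X: "finite ?X" using fin by simp
  have "det_on ?X ?Q * det_on ?X ?Q' = det_on ?X kdelta"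
    unfolding det_on_mult[OF fin_X, symmetric] mult_on_kron
    using fin P(3) by (intro det_on_cong)
      (auto simp: kron_def mult_on_curry_mat[OF P(1,2)] mult_on_kdelta kdelta_def split: if_splits)
  then have nonzero: "det_on ?X ?Q \<noteq> 0"
    using fin_X by (auto simp: det_on_kdelta)
  have "mult_on ?X ?Q (?A \<pi>) p q = mult_on ?X (?A \<pi>') ?Q p q" if p: "p \<in> ?X" and q: "q \<in> ?X" for p q
  proof -
    obtain a e b f where ab: "p = (a, e)" "q = (b, f)" "a < d" "e \<in> E" "b < d" "f \<in> E" using p q by auto
    have "(P * \<pi> g) $$ (a, b) = (\<pi>' g * P) $$ (a, b)" if "g \<in> carrier \<Gamma>" for g
      using intertwine[OF that] by simp
    then show ?thesis
      unfolding mult_on_sum_left mult_on_sum_right mult_on_kron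
      using fin ab P(1) representation_carrier[OF \<pi>] representation_carrier[OF \<pi>'] d
      by (intro sum.cong) (auto simp: kron_def mult_on_curry_mat[of _ d d _ d] mult_on_kdelta)
  qed
  then have "det_on ?X (mult_on ?X ?Q (?A \<pi>)) = det_on ?X (mult_on ?X (?A \<pi>') ?Q)"
    by (rule det_on_cong)
  then show ?thesis
    using nonzero d by (simp add: det_on_mult[OF fin_X] twisted_det_def)
qed

lemma twisted_det_extension:
  assumes fin: "finite E" and ext: "extension_representation \<Gamma> r \<sigma> s \<tau> \<pi>"
  shows "twisted_det \<Gamma> (r + s) \<pi> E W = twisted_det \<Gamma> r \<sigma> E W * twisted_det \<Gamma> s \<tau> E W"
proof -
  have \<sigma>: "\<sigma> g \<in> carrier_mat r r" and \<tau>: "\<tau> g \<in> carrier_mat s s" if "g \<in> carrier \<Gamma>" for g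
    using ext that by (auto simp: extension_representation_def intro: representation_carrier)
  have block: "\<exists>N\<in>carrier_mat r s. \<pi> g = four_block_mat (\<sigma> g) N (0\<^sub>m s r) (\<tau> g)" if "g \<in> carrier \<Gamma>" for g
    using ext that by (simp add: extension_representation_def)
  have upper_left: "\<pi> g $$ (a, b) = \<sigma> g $$ (a, b)" if "g \<in> carrier \<Gamma>" "a < r" "b < r" for g a b
    using block[OF that(1)] \<sigma>[OF that(1)] that by auto
  have lower_right: "\<pi> g $$ (r + a, r + b) = \<tau> g $$ (a, b)" if "g \<in> carrier \<Gamma>" "a < s" "b < s" for g a b
    using block[OF that(1)] \<sigma>[OF that(1)] \<tau>[OF that(1)] that by auto
  have lower_left: "\<pi> g $$ (r + a, b) = 0" if "g \<in> carrier \<Gamma>" "a < s" "b < r" for g a b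
    using block[OF that(1)] \<sigma>[OF that(1)] \<tau>[OF that(1)] that by auto
  let ?A = "\<lambda>\<pi> p q. \<Sum>g\<in>carrier \<Gamma>. kron (curry (($$) (\<pi> g))) (W g) p q"
  let ?S = "{..<r} \<times> E" and ?T = "((+) r ` {..<s}) \<times> E"
  have "twisted_det \<Gamma> (r + s) \<pi> E W = det_on (?S \<union> ?T) (?A \<pi>)"
    unfolding twisted_det_def lessThan_add Times_Un_distrib1 ..
  also have "\<dots> = det_on ?S (?A \<pi>) * det_on ?T (?A \<pi>)"
    using fin by (intro det_on_Un_block_triangular) (auto simp: kron_def lower_left intro!: sum.neutral)
  also have "det_on ?S (?A \<pi>) = twisted_det \<Gamma> r \<sigma> E W"
    unfolding twisted_det_def by (rule det_on_cong) (auto simp: kron_def upper_left intro!: sum.cong)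
  also have "det_on ?T (?A \<pi>) = twisted_det \<Gamma> s \<tau> E W"
  proof -
    have "bij_betw (map_prod ((+) r) id) ({..<s} \<times> E) ?T"
      by (auto simp: bij_betw_def inj_on_def image_iff)
    from det_on_reindex[OF _ this, of "?A \<pi>"] fin
    have "det_on ?T (?A \<pi>) =
        det_on ({..<s} \<times> E) (\<lambda>p q. ?A \<pi> (map_prod ((+) r) id p) (map_prod ((+) r) id q))" by simp
    also have "\<dots> = twisted_det \<Gamma> s \<tau> E W"
      unfolding twisted_det_def by (rule det_on_cong) (auto simp: kron_def lower_right intro!: sum.cong)
    finally show ?thesis .
  qed
  finally show ?thesis .
qed

lemma (in group) composition_factors:
  assumes irr: "all_irreducible_representations G k f \<rho>" and \<pi>: "group_representation G d \<pi>"
    and fin: "finite E"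
  obtains c :: "nat \<Rightarrow> nat" where
    "\<And>g. g \<in> carrier G \<Longrightarrow> mat_trace (\<pi> g) = (\<Sum>i = 1..k. of_nat (c i) * mat_trace (\<rho> i g))"
    "\<And>W. twisted_det G d \<pi> E W = (\<Prod>i = 1..k. twisted_det G (f i) (\<rho> i) E W ^ c i)"
proof -
  define factors where "factors c d \<pi> \<longleftrightarrow>
    (\<forall>g\<in>carrier G. mat_trace (\<pi> g) = (\<Sum>i = 1..k. of_nat (c i) * mat_trace (\<rho> i g))) \<and>
    (\<forall>W. twisted_det G d \<pi> E W = (\<Prod>i = 1..k. twisted_det G (f i) (\<rho> i) E W ^ c i))"
    for c :: "nat \<Rightarrow> nat" and d \<pi>
  note rep = all_irreducible_imp_representation[OF irr]
  have "\<exists>c. factors c d \<pi>"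
    using \<pi>
  proof (induction rule: representation_induct)
    case (zero \<pi>)
    then have "factors (\<lambda>_. 0) 0 \<pi>"
      using representation_carrier by (fastforce simp: factors_def twisted_det_zero mat_trace_def)
    then show ?case by blast
  next
    case (irreducible d \<pi>)
    then obtain i where i: "i \<in> {1..k}" "equivalent_representations G d \<pi> (f i) (\<rho> i)"
      using irr unfolding all_irreducible_representations_def by blast
    note \<pi> = irreducible_imp_representation[OF irreducible]
    have "(\<Sum>j = 1..k. of_nat (kdelta i j) * F j) = F i" "(\<Prod>j = 1..k. F j ^ kdelta i j) = F i"
      for F :: "nat \<Rightarrow> complex"
      using i(1)
      by (simp_all add: kdelta_def if_distrib if_distribR sum.delta' prod.delta' cong: if_cong)
    then have "factors (kdelta i) d \<pi>"
      using i(1) unfolding factors_def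
      by (simp add: mat_trace_equivalent_representations[OF \<pi> rep i(2)]
        twisted_det_equivalent[OF fin \<pi> rep i(2)])
    then show ?case by blast
  next
    case (equivalent d \<pi> \<pi>')
    then show ?case
      unfolding factors_def
      by (simp add: mat_trace_equivalent_representations twisted_det_equivalent[OF fin])
  next
    case (extension r \<sigma> s \<tau> \<pi>)
    then obtain b c where "factors b r \<sigma>" "factors c s \<tau>" by blast
    then have "factors (\<lambda>i. b i + c i) (r + s) \<pi>"
      using extension(1) unfolding factors_def
      by (simp add: mat_trace_extension_representation twisted_det_extension[OF fin]
          distrib_right sum.distrib power_add prod.distrib)
    then show ?case by blast
  qed
  then show ?thesis using that unfolding factors_def by blast
qed

lemma mat_trace_rect_mat:
  assumes "enumerates xs S"
  shows "mat_trace (rect_mat xs xs F) = (\<Sum>x\<in>S. F x x)"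
  using sum.reindex_bij_betw[OF bij_betw_nth_enumerates[OF assms], of "\<lambda>x. F x x"]
  by (simp add: mat_trace_def rect_mat_def lessThan_atLeast0)

definition regular_representation :: "('g, 'b) monoid_scheme \<Rightarrow> 'g list \<Rightarrow> 'g \<Rightarrow> complex mat" where
  "regular_representation \<Gamma> xs g = rect_mat xs xs (\<lambda>x y. kdelta (x \<otimes>\<^bsub>\<Gamma>\<^esub> g) y)"

context group
begin

lemma group_representation_regular:
  assumes xs: "enumerates xs (carrier G)"
  shows "group_representation G (Coset.order G) (regular_representation G xs)"
proof (rule representationI)
  have len: "length xs = Coset.order G" using length_enumerates[OF xs] by (simp add: Coset.order_def)
  have set: "set xs = carrier G" "distinct xs" "finite (carrier G)"
    using xs finite_enumerates[OF xs] by (simp_all add: enumerates_def)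
  show "regular_representation G xs g \<in> carrier_mat (Coset.order G) (Coset.order G)" for g
    unfolding regular_representation_def len[symmetric] by (rule rect_mat_carrier)
  have "regular_representation G xs \<one> = rect_mat xs xs kdelta"
    unfolding regular_representation_def by (rule rect_mat_cong) (simp add: set)
  then show "regular_representation G xs \<one> = 1\<^sub>m (Coset.order G)"
    using set by (simp add: rect_mat_kdelta len)
  show "regular_representation G xs (g \<otimes> h) =
      regular_representation G xs g * regular_representation G xs h"
    if "g \<in> carrier G" "h \<in> carrier G" for g h
    unfolding regular_representation_def rect_mat_mult[OF xs]
    using that set by (intro rect_mat_cong) (simp add: mult_on_def m_assoc)
qed

lemma mat_trace_regular_representation:
  assumes xs: "enumerates xs (carrier G)" and g: "g \<in> carrier G"
  shows "mat_trace (regular_representation G xs g) = of_nat (Coset.order G) * kdelta \<one> g"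
proof -
  have "x \<otimes> g = x \<longleftrightarrow> \<one> = g" if "x \<in> carrier G" for x
    using that g r_cancel_one by auto
  then show ?thesis
    unfolding regular_representation_def mat_trace_rect_mat[OF xs]
    by (simp add: kdelta_def Coset.order_def)
qed

lemma twisted_det_regular_representation:
  assumes xs: "enumerates xs (carrier G)" and fin: "finite E"
  shows "twisted_det G (Coset.order G) (regular_representation G xs) E W =
    det_on (carrier G \<times> E) (\<lambda>(x, e) (y, f). W (inv x \<otimes> y) e f)"
    (is "_ = det_on _ ?F")
proof -
  have finG: "finite (carrier G)" by (rule finite_enumerates[OF xs])
  have "bij_betw ((!) xs) {..<Coset.order G} (carrier G)"
    using bij_betw_nth_enumerates[OF xs] length_enumerates[OF xs]
    by (simp add: Coset.order_def lessThan_atLeast0)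
  then have "bij_betw (map_prod ((!) xs) id) ({..<Coset.order G} \<times> E) (carrier G \<times> E)"
    by (intro bij_betw_map_prod) auto
  then have "det_on (carrier G \<times> E) ?F =
      det_on ({..<Coset.order G} \<times> E) (\<lambda>p q. ?F (map_prod ((!) xs) id p) (map_prod ((!) xs) id q))"
    using fin by (intro det_on_reindex[symmetric]) simp_all
  also have "\<dots> = twisted_det G (Coset.order G) (regular_representation G xs) E W"
    unfolding twisted_det_def
  proof (rule det_on_cong)
    fix p q assume "p \<in> {..<Coset.order G} \<times> E" "q \<in> {..<Coset.order G} \<times> E"
    then obtain i e j f where p: "p = (i, e)" "q = (j, f)" "i < length xs" "j < length xs"
      using length_enumerates[OF xs] by (auto simp: Coset.order_def)
    then have ij: "xs ! i \<in> carrier G" "xs ! j \<in> carrier G"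
      using xs nth_mem by (auto simp: enumerates_def)
    have "kdelta (xs ! i \<otimes> g) (xs ! j) = (kdelta (inv (xs ! i) \<otimes> xs ! j) g :: complex)"
      if "g \<in> carrier G" for g
      using inv_solve_left[OF that ij] by (auto simp: kdelta_def)
    then have "(\<Sum>g\<in>carrier G. kron (curry (($$) (regular_representation G xs g))) (W g) p q) =
        (\<Sum>g\<in>carrier G. kdelta (inv (xs ! i) \<otimes> xs ! j) g * W g e f)"
      using p by (simp add: kron_def regular_representation_def rect_mat_def)
    also have "\<dots> = W (inv (xs ! i) \<otimes> xs ! j) e f"
      using finG ij by simp
    finally show "?F (map_prod ((!) xs) id p) (map_prod ((!) xs) id q) =
        (\<Sum>g\<in>carrier G. kron (curry (($$) (regular_representation G xs g))) (W g) p q)"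
      by (simp add: p)
  qed
  finally show ?thesis by simp
qed

lemma regular_composition_factors:
  assumes irr: "all_irreducible_representations G k f \<rho>" and xs: "enumerates xs (carrier G)"
    and fin: "finite E"
  shows "g \<in> carrier G \<Longrightarrow> mat_trace (regular_representation G xs g) =
      (\<Sum>i = 1..k. of_nat (f i) * mat_trace (\<rho> i g))"
    and "twisted_det G (Coset.order G) (regular_representation G xs) E W =
        (\<Prod>i = 1..k. twisted_det G (f i) (\<rho> i) E W ^ f i)"
proof -
  obtain c :: "nat \<Rightarrow> nat" where
    trace: "\<And>g. g \<in> carrier G \<Longrightarrow>
      mat_trace (regular_representation G xs g) = (\<Sum>i = 1..k. of_nat (c i) * mat_trace (\<rho> i g))"
    and det: "\<And>W. twisted_det G (Coset.order G) (regular_representation G xs) E W =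
      (\<Prod>i = 1..k. twisted_det G (f i) (\<rho> i) E W ^ c i)"
    using composition_factors[OF irr group_representation_regular[OF xs] fin] by blast
  have finG: "finite (carrier G)" by (rule finite_enumerates[OF xs])
  have "c j = f j" if j: "j \<in> {1..k}" for j
  proof -
    note rep = all_irreducible_imp_representation[OF irr j]
    have "of_nat (Coset.order G) * of_nat (c j) =
        (\<Sum>i = 1..k. of_nat (c i) * (\<Sum>g\<in>carrier G. mat_trace (\<rho> i g) * mat_trace (\<rho> j (inv g))))"
      using j by (simp add: character_orthogonality[OF irr] mult.left_commute flip: mult.assoc)
    also have "\<dots> = (\<Sum>g\<in>carrier G. mat_trace (regular_representation G xs g) * mat_trace (\<rho> j (inv g)))"
      unfolding sum_distrib_left
      by (subst sum.swap) (simp add: trace sum_distrib_right mult.assoc)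
    also have "\<dots> = (\<Sum>g\<in>carrier G. kdelta \<one> g * (of_nat (Coset.order G) * mat_trace (\<rho> j (inv g))))"
      by (simp add: mat_trace_regular_representation[OF xs] mult_ac)
    also have "\<dots> = of_nat (Coset.order G) * of_nat (f j)"
      using finG by (simp add: representation_one[OF rep] mat_trace_one)
    finally have "Coset.order G = 0 \<or> c j = f j" by simp
    moreover have "Coset.order G > 0" using finG by (simp add: order_gt_0_iff_finite)
    ultimately show "c j = f j" by simp
  qed
  then show "g \<in> carrier G \<Longrightarrow> mat_trace (regular_representation G xs g) =
      (\<Sum>i = 1..k. of_nat (f i) * mat_trace (\<rho> i g))"
    and "twisted_det G (Coset.order G) (regular_representation G xs) E W =
        (\<Prod>i = 1..k. twisted_det G (f i) (\<rho> i) E W ^ f i)"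
    using trace det by simp_all
qed

lemma sum_degree_squares:
  assumes irr: "all_irreducible_representations G k f \<rho>" and fin: "finite (carrier G)"
  shows "(\<Sum>i = 1..k. (f i)\<^sup>2) = Coset.order G"
proof -
  obtain xs where xs: "enumerates xs (carrier G)" using enumerates_exists[OF fin] by blast
  note rep = all_irreducible_imp_representation[OF irr]
  have "of_nat (Coset.order G) = (\<Sum>i = 1..k. of_nat (f i) * mat_trace (\<rho> i \<one>))"
    using regular_composition_factors(1)[OF irr xs finite.emptyI one_closed]
    by (simp add: mat_trace_regular_representation[OF xs])
  also have "\<dots> = of_nat (\<Sum>i = 1..k. (f i)\<^sup>2)"
    by (simp add: representation_one[OF rep] mat_trace_one power2_eq_square)
  finally show ?thesis by (simp only: of_nat_eq_iff)
qed

lemma number_of_irreducibles_pos: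
  assumes "all_irreducible_representations G k f \<rho>" "finite (carrier G)"
  shows "0 < k"
  using sum_degree_squares[OF assms] assms(2) order_gt_0_iff_finite by (cases k) auto

theorem group_determinant_factorization:
  assumes irr: "all_irreducible_representations G k f \<rho>" and fin: "finite (carrier G)" "finite E"
  shows "det_on (carrier G \<times> E) (\<lambda>(x, e) (y, e'). W (inv x \<otimes> y) e e') =
    (\<Prod>i = 1..k. twisted_det G (f i) (\<rho> i) E W ^ f i)"
proof -
  obtain xs where xs: "enumerates xs (carrier G)" using enumerates_exists[OF fin(1)] by blast
  show ?thesis
    using regular_composition_factors(2)[OF irr xs fin(2)]
    by (simp only: twisted_det_regular_representation[OF xs fin(2)])
qed

end

section \<open>Twisted arc reversal and bond scattering\<close>

lemma arc_orientation:
  assumes fin: "finite E" and sym: "\<And>e. e \<in> E \<Longrightarrow> prod.swap e \<in> E" and irrefl: "\<And>e. e \<in> E \<Longrightarrow> fst e \<noteq> snd e"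
  obtains P where "E = P \<union> prod.swap ` P" "P \<inter> prod.swap ` P = {}"
proof -
  let ?V = "fst ` E \<union> snd ` E"
  have "finite ?V" using fin by simp
  then obtain \<phi> :: "'a \<Rightarrow> nat" where inj: "inj_on \<phi> ?V"
    using finite_imp_inj_to_nat_seg by metis
  define P where "P = {e \<in> E. \<phi> (fst e) < \<phi> (snd e)}"
  have "e \<in> P \<union> prod.swap ` P" if e: "e \<in> E" for e
  proof -
    have "\<phi> (fst e) \<noteq> \<phi> (snd e)" using e by (intro inj_on_contraD[OF inj irrefl[OF e]]) auto
    then have "e \<in> P \<or> prod.swap e \<in> P" using sym[OF e] e by (auto simp: P_def)
    then show ?thesis using image_eqI[of e prod.swap "prod.swap e" P] by auto
  qed
  moreover have "P \<union> prod.swap ` P \<subseteq> E" using sym by (auto simp: P_def)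
  moreover have "P \<inter> prod.swap ` P = {}" by (auto simp: P_def)
  ultimately show ?thesis using that[of P] by blast
qed

locale twisted_arcs =
  fixes E :: "('a \<times> 'a) set" and S :: "'i set" and r :: "'a \<times> 'a \<Rightarrow> 'i \<Rightarrow> 'i \<Rightarrow> 'c :: field"
  assumes finite_arcs: "finite E" and finite_index: "finite S"
    and arcs_sym: "\<And>e. e \<in> E \<Longrightarrow> prod.swap e \<in> E" and arcs_irrefl: "\<And>e. e \<in> E \<Longrightarrow> fst e \<noteq> snd e"
    and twist_inverse: "\<And>e a b. e \<in> E \<Longrightarrow> a \<in> S \<Longrightarrow> b \<in> S \<Longrightarrow>
      mult_on S (r e) (r (prod.swap e)) a b = kdelta a b"
begin

definition reversal :: "'i \<times> 'a \<times> 'a \<Rightarrow> 'i \<times> 'a \<times> 'a \<Rightarrow> 'c" where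
  "reversal = (\<lambda>(a, e) (b, f). r e a b * kdelta (prod.swap e) f)"

lemma mult_on_reversal:
  assumes "finite P" "prod.swap e \<in> P"
  shows "mult_on (S \<times> P) reversal K (a, e) z = mult_on S (r e) (\<lambda>b. K (b, prod.swap e)) a z"
proof -
  have "mult_on (S \<times> P) reversal K (a, e) z =
      (\<Sum>b\<in>S. \<Sum>f\<in>P. kdelta (prod.swap e) f * (r e a b * K (b, f) z))"
    by (simp add: mult_on_def reversal_def sum.cartesian_product' mult_ac)
  then show ?thesis using assms by (simp add: mult_on_def)
qed

lemma det_one_minus_reversal:
  assumes m: "card E = 2 * m"
  shows "det_on (S \<times> E) (\<lambda>x y. kdelta x y - c * reversal x y) = (1 - c\<^sup>2) ^ (m * card S)"
proof -
  \<comment> \<open>Choosing one arc of each edge splits the matrix into blocks with identity diagonal blocks.\<close>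
  obtain P where E: "E = P \<union> prod.swap ` P" and disj: "P \<inter> prod.swap ` P = {}"
    using arc_orientation[OF finite_arcs arcs_sym arcs_irrefl] by metis
  let ?N = "prod.swap ` P" and ?F = "\<lambda>x y. kdelta x y - c * reversal x y"
  have fin: "finite P" "finite ?N" using finite_arcs E by auto
  have "card ?N = card P" by (intro card_image) simp
  then have card_N: "card ?N = m" using card_Un_disjoint[OF fin disj] m E by simp
  have swap_N: "prod.swap e \<in> P" if "e \<in> ?N" for e using that by auto
  have swap_P: "prod.swap e \<notin> P" if "e \<in> P" for e using that disj by auto
  have reversal_P: "reversal x y = 0" if "x \<in> S \<times> P" "y \<in> S \<times> P" for x y
    using that swap_P by (fastforce simp: reversal_def kdelta_def)
  have reversal_N: "reversal x y = 0" if "x \<in> S \<times> ?N" "y \<in> S \<times> ?N" for x y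
    using that swap_N disj by (fastforce simp: reversal_def kdelta_def)
  have "det_on (S \<times> E) ?F = det_on (S \<times> P \<union> S \<times> ?N) ?F"
    by (simp only: E Sigma_Un_distrib2)
  also have "\<dots> = det_on (S \<times> ?N) (\<lambda>x y. ?F x y - mult_on (S \<times> P) ?F ?F x y)"
    using fin finite_index disj reversal_P by (intro det_on_Un_schur_complement) auto
  also have "\<dots> = det_on (S \<times> ?N) (\<lambda>x y. kdelta x y * (1 - c\<^sup>2))"
  proof (rule det_on_cong)
    fix x y assume x: "x \<in> S \<times> ?N" and y: "y \<in> S \<times> ?N"
    obtain a e b f where ae: "x = (a, e)" "y = (b, f)" "a \<in> S" "e \<in> ?N" "b \<in> S" "f \<in> ?N"
      using x y by auto
    have "mult_on (S \<times> P) ?F ?F x y =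
        mult_on (S \<times> P) (\<lambda>x y. c * reversal x y) (\<lambda>x y. c * reversal x y) x y"
      unfolding mult_on_def using x y disj by (intro sum.cong) (auto simp: kdelta_def)
    also have "\<dots> = c\<^sup>2 * mult_on (S \<times> P) reversal reversal x y"
      by (simp add: mult_on_def sum_distrib_left power2_eq_square mult_ac)
    also have "mult_on (S \<times> P) reversal reversal x y =
        mult_on S (r e) (r (prod.swap e)) a b * kdelta e f"
      unfolding ae(1,2) mult_on_reversal[OF fin(1) swap_N[OF ae(4)]]
      by (simp add: mult_on_def reversal_def sum_distrib_right mult.assoc)
    also have "\<dots> = kdelta x y"
      using ae E by (simp add: twist_inverse kdelta_Pair)
    finally show "?F x y - mult_on (S \<times> P) ?F ?F x y = kdelta x y * (1 - c\<^sup>2)"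
      using reversal_N[OF x y] by (simp add: algebra_simps)
  qed
  also have "\<dots> = (1 - c\<^sup>2) ^ (m * card S)"
    using fin finite_index
    by (simp add: det_on_mult_diagonal det_on_kdelta card_cartesian_product card_N mult.commute)
  finally show ?thesis .
qed

definition in_incidence :: "('a \<times> 'a \<Rightarrow> 'c) \<Rightarrow> 'i \<times> 'a \<times> 'a \<Rightarrow> 'i \<times> 'a \<Rightarrow> 'c" where
  "in_incidence w = (\<lambda>(a, e) (b, v). r e a b * w e * kdelta (snd e) v)"

\<comment> \<open>\<open>J T\<close> in matrix notation, where \<open>J\<close> is \<open>reversal\<close> and \<open>T\<close> is \<open>in_incidence w\<close>.\<close>
definition back_incidence :: "('a \<times> 'a \<Rightarrow> 'c) \<Rightarrow> 'i \<times> 'a \<times> 'a \<Rightarrow> 'i \<times> 'a \<Rightarrow> 'c" where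
  "back_incidence w = (\<lambda>(a, e) (b, v). kdelta a b * w (prod.swap e) * kdelta (fst e) v)"

definition out_incidence :: "('a \<times> 'a \<Rightarrow> 'c) \<Rightarrow> 'i \<times> 'a \<Rightarrow> 'i \<times> 'a \<times> 'a \<Rightarrow> 'c" where
  "out_incidence w = (\<lambda>(b, v) (a, e). kdelta b a * w e * kdelta v (fst e))"

lemma reversal_in_incidence:
  assumes "a \<in> S" "e \<in> E" "b \<in> S"
  shows "mult_on (S \<times> E) reversal (in_incidence w) (a, e) (b, v) = back_incidence w (a, e) (b, v)"
proof -
  have "mult_on (S \<times> E) reversal (in_incidence w) (a, e) (b, v) =
      mult_on S (r e) (r (prod.swap e)) a b * w (prod.swap e) * kdelta (fst e) v"
    using assms finite_arcs arcs_sym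
    by (simp add: mult_on_reversal, simp add: mult_on_def in_incidence_def sum_distrib_right mult.assoc)
  then show ?thesis using assms by (simp add: twist_inverse back_incidence_def)
qed

lemma reversal_back_incidence:
  assumes "e \<in> E" "b \<in> S"
  shows "mult_on (S \<times> E) reversal (back_incidence w) (a, e) (b, v) = in_incidence w (a, e) (b, v)"
proof -
  have "mult_on (S \<times> E) reversal (back_incidence w) (a, e) (b, v) =
      (\<Sum>b'\<in>S. r e a b' * w e * kdelta (snd e) v * kdelta b' b)"
    using assms finite_arcs arcs_sym
    by (simp add: mult_on_reversal, simp add: mult_on_def back_incidence_def mult_ac)
  then show ?thesis using assms finite_index by (simp add: in_incidence_def)
qed

lemma mult_on_out_incidence_right:
  assumes "finite V" "fst f \<in> V" "b \<in> S"
  shows "mult_on (S \<times> V) K (out_incidence w) x (b, f) = K x (b, fst f) * w f"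
proof -
  have "mult_on (S \<times> V) K (out_incidence w) x (b, f) =
      (\<Sum>a\<in>S. \<Sum>v\<in>V. K x (a, v) * (kdelta a b * w f) * kdelta v (fst f))"
    by (simp add: mult_on_def sum.cartesian_product' out_incidence_def mult.assoc)
  also have "\<dots> = (\<Sum>a\<in>S. K x (a, fst f) * w f * kdelta a b)"
    using assms by (simp, simp add: mult_ac)
  finally show ?thesis using assms finite_index by simp
qed

lemma mult_on_out_incidence_left:
  assumes "b \<in> S"
  shows "mult_on (S \<times> E) (out_incidence w) K (b, u) z = (\<Sum>e\<in>{e \<in> E. fst e = u}. w e * K (b, e) z)"
proof -
  have "mult_on (S \<times> E) (out_incidence w) K (b, u) z =
      (\<Sum>e\<in>E. \<Sum>a\<in>S. kdelta b a * (w e * kdelta u (fst e) * K (a, e) z))"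
    unfolding mult_on_def sum.cartesian_product'
    by (subst sum.swap) (simp add: out_incidence_def mult.assoc)
  also have "\<dots> = (\<Sum>e\<in>E. w e * kdelta u (fst e) * K (b, e) z)"
    using assms finite_index by simp
  also have "\<dots> = (\<Sum>e\<in>E. if fst e = u then w e * K (b, e) z else 0)"
    by (intro sum.cong) (auto simp: kdelta_def)
  finally show ?thesis using finite_arcs by (simp add: sum.inter_filter)
qed

lemma one_minus_reversal_incidence:
  assumes x: "x \<in> S \<times> E" and b: "b \<in> S"
  shows "mult_on (S \<times> E) (\<lambda>x y. kdelta x y - c * reversal x y)
      (\<lambda>x (b, v). (in_incidence w x (b, v) + c * back_incidence w x (b, v)) / D v) x (b, v) =
    (1 - c\<^sup>2) * in_incidence w x (b, v) / D v"
proof -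
  let ?X = "\<lambda>x (b, v). (in_incidence w x (b, v) + c * back_incidence w x (b, v)) / D v"
  obtain a e where ae: "x = (a, e)" "a \<in> S" "e \<in> E" using x by auto
  have "mult_on (S \<times> E) (\<lambda>x y. kdelta x y - c * reversal x y) ?X x (b, v) =
      ?X x (b, v) - c * mult_on (S \<times> E) reversal ?X x (b, v)"
    using x finite_arcs finite_index by (simp add: mult_on_kdelta_diff)
  also have "mult_on (S \<times> E) reversal ?X x (b, v) =
      (mult_on (S \<times> E) reversal (in_incidence w) x (b, v)
        + c * mult_on (S \<times> E) reversal (back_incidence w) x (b, v)) / D v"
    by (simp add: mult_on_def sum_distrib_left sum_divide_distrib add_divide_distrib distrib_left
        sum.distrib mult.left_commute)
  also have "\<dots> = (back_incidence w x (b, v) + c * in_incidence w x (b, v)) / D v"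
    using ae b by (simp add: reversal_in_incidence reversal_back_incidence)
  finally show ?thesis
    by (simp add: power2_eq_square diff_divide_distrib add_divide_distrib algebra_simps)
qed

lemma out_incidence_incidence:
  assumes "b \<in> S" "b' \<in> S"
  shows "mult_on (S \<times> E) (out_incidence w)
      (\<lambda>x y. in_incidence w x y + c * back_incidence w x y) (b, u) (b', v) =
    kdelta (b, u) (b', v) * (c * (\<Sum>f\<in>{f \<in> E. fst f = u}. w f * w (prod.swap f)))
      + (if (u, v) \<in> E then (w (u, v))\<^sup>2 * r (u, v) b b' else 0)"
proof -
  let ?E = "{f \<in> E. fst f = u}"
  have "mult_on (S \<times> E) (out_incidence w) (in_incidence w) (b, u) (b', v) =
      (\<Sum>e\<in>?E. kdelta e (u, v) * ((w e)\<^sup>2 * r e b b'))"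
    unfolding mult_on_out_incidence_left[OF assms(1)]
    by (intro sum.cong) (auto simp: in_incidence_def kdelta_def power2_eq_square)
  also have "\<dots> = (if (u, v) \<in> E then (w (u, v))\<^sup>2 * r (u, v) b b' else 0)"
    using finite_arcs by simp
  moreover have "mult_on (S \<times> E) (out_incidence w) (back_incidence w) (b, u) (b', v) =
      kdelta (b, u) (b', v) * (\<Sum>f\<in>?E. w f * w (prod.swap f))"
    unfolding mult_on_out_incidence_left[OF assms(1)] sum_distrib_left
    by (intro sum.cong) (auto simp: back_incidence_def kdelta_def)
  ultimately show ?thesis
    by (simp add: mult_on_def distrib_left sum.distrib mult.left_commute flip: sum_distrib_left)
qed

theorem det_one_minus_bond_scattering:
  fixes w :: "'a \<times> 'a \<Rightarrow> 'c" and D :: "'a \<Rightarrow> 'c"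
  assumes V: "finite V" "E \<subseteq> V \<times> V" and D: "\<And>v. v \<in> V \<Longrightarrow> D v \<noteq> 0" and m: "card E = 2 * m"
  shows "det_on (S \<times> E) (\<lambda>(a, e) (b, f). kdelta (a, e) (b, f) - r e a b *
            (if snd e = fst f
             then c * kdelta (prod.swap e) f - (1 - c\<^sup>2) * (w e * w f / D (snd e)) else 0)) =
         (1 - c\<^sup>2) ^ (m * card S) / prod D V ^ card S *
         det_on (S \<times> V) (\<lambda>(b, u) (b', v).
            kdelta (b, u) (b', v) * (D u + c * (\<Sum>f\<in>{f \<in> E. fst f = u}. w f * w (prod.swap f)))
            + (if (u, v) \<in> E then (w (u, v))\<^sup>2 * r (u, v) b b' else 0))"
    (is "det_on _ ?bond = _ * det_on _ ?hop")
proof -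
  let ?M = "\<lambda>x y. kdelta x y - c * reversal x y"
  let ?X = "\<lambda>x (b, v). (in_incidence w x (b, v) + c * back_incidence w x (b, v)) / D v"
  let ?Y = "out_incidence w"
  have fin: "finite (S \<times> E)" "finite (S \<times> V)" using finite_arcs finite_index V(1) by auto
  have "det_on (S \<times> E) ?bond =
      det_on (S \<times> E) (mult_on (S \<times> E) ?M (\<lambda>x y. kdelta x y + mult_on (S \<times> V) ?X ?Y x y))"
  proof (rule det_on_cong)
    fix x y assume x: "x \<in> S \<times> E" and "y \<in> S \<times> E"
    then obtain a e b f where ae: "x = (a, e)" "y = (b, f)" "a \<in> S" "e \<in> E" "b \<in> S" "f \<in> E" by auto
    have "mult_on (S \<times> E) ?M (\<lambda>x y. kdelta x y + mult_on (S \<times> V) ?X ?Y x y) x y =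
        ?M x y + mult_on (S \<times> E) ?M ?X x (b, fst f) * w f"
      using ae V fin by (subst mult_on_add_right, subst mult_on_assoc[symmetric])
        (auto simp: mult_on_kdelta mult_on_out_incidence_right)
    also have "\<dots> = ?M x y + (1 - c\<^sup>2) * in_incidence w x (b, fst f) / D (fst f) * w f"
      using x ae by (simp only: one_minus_reversal_incidence)
    also have "\<dots> = ?bond x y"
      by (cases "snd e = fst f")
        (auto simp: ae(1,2) reversal_def in_incidence_def kdelta_def algebra_simps)
    finally show "?bond x y = mult_on (S \<times> E) ?M (\<lambda>x y. kdelta x y + mult_on (S \<times> V) ?X ?Y x y) x y" ..
  qed
  also have "\<dots> =
      (1 - c\<^sup>2) ^ (m * card S) * det_on (S \<times> V) (\<lambda>y y'. kdelta y y' + mult_on (S \<times> E) ?Y ?X y y')"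
    unfolding det_on_mult[OF fin(1)] det_one_minus_reversal[OF m] det_on_one_add_mult_commute[OF fin] ..
  finally have bond: "det_on (S \<times> E) ?bond = \<dots>" .
  have "det_on (S \<times> V) ?hop =
      det_on (S \<times> V) (\<lambda>y y'. (kdelta y y' + mult_on (S \<times> E) ?Y ?X y y') * D (snd y'))"
  proof (rule det_on_cong)
    fix y y' assume "y \<in> S \<times> V" "y' \<in> S \<times> V"
    then obtain b u b' v where bu: "y = (b, u)" "y' = (b', v)" "b \<in> S" "u \<in> V" "b' \<in> S" "v \<in> V" by auto
    have "mult_on (S \<times> E) ?Y ?X y y' * D v =
        mult_on (S \<times> E) ?Y (\<lambda>x y. in_incidence w x y + c * back_incidence w x y) y y'"
      using D[OF bu(6)] by (simp add: mult_on_def sum_distrib_right bu(2))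
    then show "?hop y y' = (kdelta y y' + mult_on (S \<times> E) ?Y ?X y y') * D (snd y')"
      using bu by (auto simp: out_incidence_incidence kdelta_def algebra_simps)
  qed
  also have "\<dots> = det_on (S \<times> V) (\<lambda>y y'. kdelta y y' + mult_on (S \<times> E) ?Y ?X y y') * prod D V ^ card S"
    using prod.cartesian_product[of "\<lambda>_. D" V S] by (simp add: det_on_mult_diagonal case_prod_unfold)
  finally show ?thesis
    using D V(1) by (simp add: bond)
qed

end

section \<open>Kronecker products as matrices over pairs\<close>

lemma index_mat_carrier [simp]: "index_mat xs F \<in> carrier_mat (length xs) (length xs)"
  by (simp add: index_mat_def)

lemma index_mat_diff: "index_mat xs F - index_mat xs K = index_mat xs (\<lambda>x y. F x y - K x y)"
  by (rule eq_matI) (auto simp: index_mat_def)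

lemma smult_index_mat: "c \<cdot>\<^sub>m index_mat xs F = index_mat xs (\<lambda>x y. c * F x y)"
  by (rule eq_matI) (auto simp: index_mat_def)

lemma index_mat_kdelta: "enumerates xs S \<Longrightarrow> index_mat xs kdelta = 1\<^sub>m (card S)"
  using rect_mat_kdelta[of xs] length_enumerates[of xs S]
  by (simp add: index_mat_eq_rect_mat enumerates_def)

lemma det_index_mat: "enumerates xs S \<Longrightarrow> det (index_mat xs F) = det_on S F"
  by (simp add: index_mat_eq_rect_mat det_rect_mat)

lemma index_mat_diagonal:
  assumes "distinct xs"
  shows "index_mat xs (\<lambda>x y. kdelta x y * d x) = mat_diag (length xs) (\<lambda>j. d (xs ! j))"
  using assms by (intro eq_matI) (auto simp: index_mat_def mat_diag_def kdelta_def nth_eq_iff_index_eq)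

lemma finsum_index_mat:
  assumes "finite A"
  shows "(\<Oplus>\<^bsub>module_mat TYPE(complex) (length xs) (length xs)\<^esub> g \<in> A. index_mat xs (F g)) =
    index_mat xs (\<lambda>x y. \<Sum>g\<in>A. F g x y)"
proof -
  interpret abelian_group "module_mat TYPE(complex) (length xs) (length xs)" by (rule abelian_group_mat)
  show ?thesis
    using assms
  proof (induction A)
    case empty
    show ?case by (auto simp: module_mat_simps index_mat_def intro!: eq_matI)
  next
    case (insert g A)
    have "(\<Oplus>\<^bsub>module_mat TYPE(complex) (length xs) (length xs)\<^esub> g \<in> insert g A. index_mat xs (F g)) =
        index_mat xs (F g) + index_mat xs (\<lambda>x y. \<Sum>g\<in>A. F g x y)"
      using insert by (subst finsum_insert) (auto simp: module_mat_simps)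
    also have "\<dots> = index_mat xs (\<lambda>x y. \<Sum>g\<in>insert g A. F g x y)"
      using insert.hyps by (intro eq_matI) (auto simp: index_mat_def)
    finally show ?case .
  qed
qed

lemma kronecker_one_left: "1\<^sub>m 1 \<otimes>\<^sub>K A = A"
  by (rule eq_matI) (auto simp: kronecker_def)

lemma mod_less_if_less_mult: "i < d * n \<Longrightarrow> i mod n < (n :: nat)"
  by (cases n) auto

lemma kronecker_one: "1\<^sub>m d \<otimes>\<^sub>K 1\<^sub>m n = 1\<^sub>m (d * n)"
proof (rule eq_matI)
  fix i j assume "i < dim_row (1\<^sub>m (d * n) :: complex mat)" "j < dim_col (1\<^sub>m (d * n) :: complex mat)"
  moreover have "i = j" if "i div n = j div n" "i mod n = j mod n"
    using that by (metis div_mult_mod_eq)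
  ultimately show "(1\<^sub>m d \<otimes>\<^sub>K 1\<^sub>m n) $$ (i, j) = 1\<^sub>m (d * n) $$ (i, j)"
    by (auto simp: kronecker_def less_mult_imp_div_less mod_less_if_less_mult)
qed (simp_all add: kronecker_def)

lemma kronecker_smult_right: "A \<otimes>\<^sub>K (c \<cdot>\<^sub>m B) = c \<cdot>\<^sub>m (A \<otimes>\<^sub>K B)"
  by (rule eq_matI) (auto simp: kronecker_def mod_less_if_less_mult)

lemma kronecker_diff_right:
  assumes "B \<in> carrier_mat n m" "C \<in> carrier_mat n m"
  shows "A \<otimes>\<^sub>K (B - C) = A \<otimes>\<^sub>K B - A \<otimes>\<^sub>K C"
  using assms by (intro eq_matI) (auto simp: kronecker_def right_diff_distrib mod_less_if_less_mult)

lemma enumerates_product: "enumerates xs S \<Longrightarrow> enumerates (List.product [0..<d] xs) ({..<d} \<times> S)"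
  by (auto simp: enumerates_def distinct_product)

lemma kronecker_index_mat:
  assumes "A \<in> carrier_mat d d"
  shows "A \<otimes>\<^sub>K index_mat xs F = index_mat (List.product [0..<d] xs) (kron (curry (($$) A)) F)"
proof (rule eq_matI)
  fix i j
  assume "i < dim_row (index_mat (List.product [0..<d] xs) (kron (curry (($$) A)) F))"
    "j < dim_col (index_mat (List.product [0..<d] xs) (kron (curry (($$) A)) F))"
  then have ij: "i < d * length xs" "j < d * length xs" by (simp_all add: index_mat_def)
  then have "i div length xs < d" "j div length xs < d" "0 < length xs"
    by (auto simp: less_mult_imp_div_less)
  then show "(A \<otimes>\<^sub>K index_mat xs F) $$ (i, j) =
      index_mat (List.product [0..<d] xs) (kron (curry (($$) A)) F) $$ (i, j)"
    using ij assms by (simp add: kronecker_def index_mat_def product_nth kron_def)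
qed (use assms in \<open>auto simp: kronecker_def index_mat_def\<close>)

lemma finsum_kronecker_index_mat:
  assumes fin: "finite A" and \<rho>: "\<And>g. g \<in> A \<Longrightarrow> \<rho> g \<in> carrier_mat d d" and N: "N = d * length xs"
  shows "(\<Oplus>\<^bsub>module_mat TYPE(complex) N N\<^esub> g \<in> A. \<rho> g \<otimes>\<^sub>K index_mat xs (F g)) =
    index_mat (List.product [0..<d] xs) (\<lambda>p q. \<Sum>g\<in>A. kron (curry (($$) (\<rho> g))) (F g) p q)"
proof -
  interpret abelian_group "module_mat TYPE(complex) N N" by (rule abelian_group_mat)
  let ?zs = "List.product [0..<d] xs"
  have len: "length ?zs = N" using N by simp
  have "(\<Oplus>\<^bsub>module_mat TYPE(complex) N N\<^esub> g \<in> A. \<rho> g \<otimes>\<^sub>K index_mat xs (F g)) =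
      (\<Oplus>\<^bsub>module_mat TYPE(complex) N N\<^esub> g \<in> A. index_mat ?zs (kron (curry (($$) (\<rho> g))) (F g)))"
    using index_mat_carrier[of ?zs] unfolding len
    by (intro finsum_cong') (auto simp: kronecker_index_mat[OF \<rho>] module_mat_simps)
  then show ?thesis using finsum_index_mat[OF fin, of ?zs] by (simp only: len)
qed

lemma finsum_trivial_kronecker_index_mat:
  assumes fin: "finite A" and triv: "\<And>g. g \<in> A \<Longrightarrow> \<rho> g = 1\<^sub>m 1" and N: "N = length xs"
  shows "(\<Oplus>\<^bsub>module_mat TYPE(complex) N N\<^esub> g \<in> A. \<rho> g \<otimes>\<^sub>K index_mat xs (F g)) =
    index_mat xs (\<lambda>x y. \<Sum>g\<in>A. F g x y)"
proof -
  interpret abelian_group "module_mat TYPE(complex) N N" by (rule abelian_group_mat)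
  have "(\<Oplus>\<^bsub>module_mat TYPE(complex) N N\<^esub> g \<in> A. \<rho> g \<otimes>\<^sub>K index_mat xs (F g)) =
      (\<Oplus>\<^bsub>module_mat TYPE(complex) N N\<^esub> g \<in> A. index_mat xs (F g))"
    using index_mat_carrier[of xs] unfolding N[symmetric]
    by (intro finsum_cong') (auto simp: triv kronecker_one_left module_mat_simps simp del: One_nat_def)
  then show ?thesis using finsum_index_mat[OF fin, of xs F] by (simp only: N)
qed

lemma (in group) det_minus_finsum_kronecker:
  assumes \<rho>: "group_representation G d \<rho>" and fin: "finite (carrier G)" and xs: "enumerates xs S"
    and N: "N = d * card S"
  shows "det (1\<^sub>m d \<otimes>\<^sub>K index_mat xs K
      - (\<Oplus>\<^bsub>module_mat TYPE(complex) N N\<^esub> g \<in> carrier G. \<rho> g \<otimes>\<^sub>K index_mat xs (F g))) =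
    twisted_det G d \<rho> S (\<lambda>g x y. kdelta \<one> g * K x y - F g x y)"
proof -
  have len: "N = d * length xs" using length_enumerates[OF xs] N by simp
  have "det (1\<^sub>m d \<otimes>\<^sub>K index_mat xs K
      - (\<Oplus>\<^bsub>module_mat TYPE(complex) N N\<^esub> g \<in> carrier G. \<rho> g \<otimes>\<^sub>K index_mat xs (F g))) =
    det_on ({..<d} \<times> S) (\<lambda>p q. kron (curry (($$) (1\<^sub>m d))) K p q
      - (\<Sum>g\<in>carrier G. kron (curry (($$) (\<rho> g))) (F g) p q))"
    by (simp add: finsum_kronecker_index_mat[OF fin representation_carrier[OF \<rho>] len]
        kronecker_index_mat[OF one_carrier_mat] index_mat_diff
        det_index_mat[OF enumerates_product[OF xs]])
  also have "\<dots> = twisted_det G d \<rho> S (\<lambda>g x y. kdelta \<one> g * K x y - F g x y)"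
    unfolding twisted_det_def
    using fin by (intro det_on_cong)
      (auto simp: kron_def right_diff_distrib sum_subtractf representation_one[OF \<rho>] mult.left_commute)
  finally show ?thesis .
qed

lemma (in group) sum_representation_pencil:
  assumes \<rho>: "group_representation G d \<rho>" and fin: "finite (carrier G)" and ab: "a < d" "b < d"
    and g: "c \<noteq> 0 \<Longrightarrow> g \<in> carrier G"
  shows "(\<Sum>x\<in>carrier G. \<rho> x $$ (a, b) * (kdelta \<one> x * k - kdelta g x * c)) =
      kdelta a b * k - \<rho> g $$ (a, b) * c"
proof -
  have "(\<Sum>x\<in>carrier G. \<rho> x $$ (a, b) * (kdelta \<one> x * k - kdelta g x * c)) =
      (\<Sum>x\<in>carrier G. kdelta \<one> x * (\<rho> x $$ (a, b) * k))
      - (\<Sum>x\<in>carrier G. kdelta g x * (\<rho> x $$ (a, b) * c))"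
    unfolding sum_subtractf[symmetric] by (intro sum.cong refl) (simp add: algebra_simps)
  then show ?thesis
    using fin ab g by (auto simp: representation_one[OF \<rho>] kdelta_def[of a b])
qed

section \<open>Coverings of weighted graphs\<close>

locale weighted_graph =
  fixes G :: "'a pair_pre_digraph" and H :: "'a \<Rightarrow> real" and h \<gamma> :: "'a \<times> 'a \<Rightarrow> real" and \<mu> :: complex
  assumes graph: "pair_graph G" and arc_data: "arc_data G h \<gamma>"
    and denom_nonzero: "\<And>u. u \<in> pverts G \<Longrightarrow> resolvent_denom G H h \<mu> u \<noteq> 0"
begin

lemma arcs_finite: "finite (parcs G)" and verts_finite: "finite (pverts G)"
  using graph
  by (simp_all add: pair_graph_def pair_digraph_def pair_fin_digraph_def pair_fin_digraph_axioms_def)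

lemma arc_swap: "e \<in> parcs G \<Longrightarrow> prod.swap e \<in> parcs G"
proof -
  interpret pair_graph G by (rule graph)
  show "e \<in> parcs G \<Longrightarrow> prod.swap e \<in> parcs G"
    using pair_sym_arcs by (cases e) (auto simp: symmetric_def sym_def)
qed

lemma arcs_subset: "parcs G \<subseteq> pverts G \<times> pverts G" and arc_no_loop: "e \<in> parcs G \<Longrightarrow> fst e \<noteq> snd e"
proof -
  interpret pair_graph G by (rule graph)
  show "parcs G \<subseteq> pverts G \<times> pverts G"
    by (rule subsetI) (simp add: mem_Times_iff arc_fst_in_verts arc_snd_in_verts)
  show "e \<in> parcs G \<Longrightarrow> fst e \<noteq> snd e" by (rule pair_no_loops)
qed

definition amplitude :: "'a \<times> 'a \<Rightarrow> complex" where
  "amplitude e = of_real (sqrt (h e)) * exp (\<i> * of_real (\<gamma> e))"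

definition bond_scattering :: "'a \<times> 'a \<Rightarrow> 'a \<times> 'a \<Rightarrow> complex" where
  "bond_scattering e f = (if snd e = fst f then scattering G H h \<gamma> \<mu> (snd e) e f else 0)"

definition hopping :: "'a \<Rightarrow> 'a \<Rightarrow> complex" where
  "hopping u v =
      (if (u, v) \<in> parcs G then of_real (h (u, v)) * exp (2 * \<i> * of_real (\<gamma> (u, v))) else 0)"

lemma bond_scattering_eq_amplitude:
  "bond_scattering e f = (if snd e = fst f
     then \<i> * kdelta (prod.swap e) f
       - 2 * (amplitude e * amplitude f / resolvent_denom G H h \<mu> (snd e))
     else 0)"
  by (simp add: bond_scattering_def scattering_def kdelta_def amplitude_def exp_add distrib_left)

lemma hopping_eq_amplitude: "hopping u v = (if (u, v) \<in> parcs G then (amplitude (u, v))\<^sup>2 else 0)"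
  using arc_data
  by (simp add: hopping_def amplitude_def arc_data_def power_mult_distrib exp_double mult.assoc
    flip: of_real_power)

lemma sum_amplitude_mult_swap:
  "(\<Sum>f\<in>{f \<in> parcs G. fst f = u}. amplitude f * amplitude (prod.swap f)) = of_real (out_weight G h u)"
proof -
  have "amplitude e * amplitude (prod.swap e) = of_real (h e)" if e: "e \<in> parcs G" for e
  proof -
    have "amplitude e * amplitude (prod.swap e) =
        of_real (sqrt (h e)) * of_real (sqrt (h e)) *
        (exp (\<i> * of_real (\<gamma> e)) * exp (- (\<i> * of_real (\<gamma> e))))"
      using arc_data e unfolding amplitude_def arc_data_def by simp
    also have "of_real (sqrt (h e)) * of_real (sqrt (h e)) = complex_of_real (h e)"
      using arc_data e by (simp add: arc_data_def flip: of_real_mult)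
    finally show ?thesis by (simp add: exp_minus_inverse)
  qed
  then show ?thesis by (simp add: out_weight_def)
qed

lemma bond_scattering_mat_eq: "bond_scattering_mat G H h \<gamma> \<mu> es = index_mat es bond_scattering"
  unfolding bond_scattering_mat_def
  by (intro arg_cong[where f = "index_mat es"] ext) (simp add: bond_scattering_def)

lemma hermitian_mat_eq:
  "hermitian_mat G H h \<gamma> vs = index_mat vs (\<lambda>u v. kdelta u v * of_real (H u) + hopping u v)"
proof -
  have "(if u = v then of_real (H u) else if (u, v) \<in> parcs G
      then of_real (h (u, v)) * exp (2 * \<i> * of_real (\<gamma> (u, v))) else 0) =
      kdelta u v * of_real (H u) + hopping u v" for u v
    using arc_no_loop[of "(u, v)"] by (auto simp: hopping_def kdelta_def)
  then show ?thesis by (simp add: hermitian_mat_def)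
qed

end

locale voltage_graph = weighted_graph G H h \<gamma> \<mu> + group \<Gamma>
  for G :: "'a pair_pre_digraph" and H :: "'a \<Rightarrow> real" and h \<gamma> :: "'a \<times> 'a \<Rightarrow> real" and \<mu> :: complex
    and \<Gamma> :: "('g, 'b) monoid_scheme" (structure) +
  fixes \<alpha> :: "'a \<times> 'a \<Rightarrow> 'g" and n m :: nat
  assumes group_finite: "finite (carrier \<Gamma>)" and voltage: "voltage_assignment G \<Gamma> \<alpha>"
    and card_verts: "card (pverts G) = n" and card_arcs: "card (parcs G) = 2 * m"
begin

abbreviation bond_scattering_part :: "'g \<Rightarrow> 'a \<times> 'a \<Rightarrow> 'a \<times> 'a \<Rightarrow> complex" where
  "bond_scattering_part g e f \<equiv> kdelta (\<alpha> e) g * bond_scattering e f"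

abbreviation hopping_part :: "'g \<Rightarrow> 'a \<Rightarrow> 'a \<Rightarrow> complex" where
  "hopping_part g u v \<equiv> kdelta (\<alpha> (u, v)) g * hopping u v"

lemma voltage_closed: "e \<in> parcs G \<Longrightarrow> \<alpha> e \<in> carrier \<Gamma>"
  and voltage_swap: "e \<in> parcs G \<Longrightarrow> \<alpha> (prod.swap e) = inv (\<alpha> e)"
  using voltage by (auto simp: voltage_assignment_def)

lemma bond_scattering_part_mat_eq:
  "bond_scattering_part_mat G H h \<gamma> \<mu> \<alpha> g es = index_mat es (bond_scattering_part g)"
  unfolding bond_scattering_part_mat_def
  by (intro arg_cong[where f = "index_mat es"] ext) (simp add: bond_scattering_def kdelta_def)

lemma hermitian_part_mat_eq: "hermitian_part_mat G h \<gamma> \<alpha> g vs = index_mat vs (hopping_part g)"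
  unfolding hermitian_part_mat_def
  by (intro arg_cong[where f = "index_mat vs"] ext) (simp add: hopping_def kdelta_def)

\<comment> \<open>The pencils absorb the identity into the coefficient of the unit, so that the twisted matrices and
  those of the covering are all of the form \<open>\<Sum>g. \<rho> g \<otimes> W g\<close>.\<close>
definition bond_scattering_pencil :: "'g \<Rightarrow> 'a \<times> 'a \<Rightarrow> 'a \<times> 'a \<Rightarrow> complex" where
  "bond_scattering_pencil g e f = kdelta \<one> g * kdelta e f - bond_scattering_part g e f"

definition hopping_pencil :: "'g \<Rightarrow> 'a \<Rightarrow> 'a \<Rightarrow> complex" where
  "hopping_pencil g u v = kdelta \<one> g * (kdelta u v * (\<mu> - of_real (H u))) - hopping_part g u v"

lemma one_mat_eq_index_mat:
  assumes "enumerates vs (pverts G)"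
  shows "1\<^sub>m n = index_mat vs kdelta"
  using index_mat_kdelta[OF assms] card_verts by simp

lemma mat_diag_eq_index_mat:
  assumes "enumerates vs (pverts G)"
  shows "mat_diag n (\<lambda>j. complex_of_real (H (vs ! j))) =
      index_mat vs (\<lambda>u v. kdelta u v * of_real (H u))"
  using index_mat_diagonal[of vs "\<lambda>u. complex_of_real (H u)"] length_enumerates[OF assms]
    assms card_verts
  by (simp add: enumerates_def)

lemma det_bond_scattering_parts:
  assumes \<rho>: "group_representation \<Gamma> d \<rho>" and es: "enumerates es (parcs G)"
  shows "det (1\<^sub>m (2 * m * d) - (\<Oplus>\<^bsub>module_mat TYPE(complex) (2 * m * d) (2 * m * d)\<^esub> g \<in> carrier \<Gamma>.
      \<rho> g \<otimes>\<^sub>K bond_scattering_part_mat G H h \<gamma> \<mu> \<alpha> g es)) =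
    twisted_det \<Gamma> d \<rho> (parcs G) bond_scattering_pencil"
proof -
  have "1\<^sub>m (2 * m * d) = 1\<^sub>m d \<otimes>\<^sub>K index_mat es kdelta"
    by (simp add: index_mat_kdelta[OF es] kronecker_one card_arcs mult.commute)
  then show ?thesis
    using det_minus_finsum_kronecker[OF \<rho> group_finite es, of "2 * m * d" kdelta bond_scattering_part]
    by (simp add: card_arcs bond_scattering_part_mat_eq bond_scattering_pencil_def[abs_def]
        mult.commute)
qed

lemma det_hermitian_parts:
  assumes \<rho>: "group_representation \<Gamma> d \<rho>" and vs: "enumerates vs (pverts G)"
  shows "det (\<mu> \<cdot>\<^sub>m 1\<^sub>m (n * d) - (\<Oplus>\<^bsub>module_mat TYPE(complex) (n * d) (n * d)\<^esub> g \<in> carrier \<Gamma>.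
      \<rho> g \<otimes>\<^sub>K hermitian_part_mat G h \<gamma> \<alpha> g vs) - 1\<^sub>m d \<otimes>\<^sub>K mat_diag n (\<lambda>j. of_real (H (vs ! j)))) =
    twisted_det \<Gamma> d \<rho> (pverts G) hopping_pencil"
proof -
  let ?S = "\<Oplus>\<^bsub>module_mat TYPE(complex) (n * d) (n * d)\<^esub> g \<in> carrier \<Gamma>.
      \<rho> g \<otimes>\<^sub>K hermitian_part_mat G h \<gamma> \<alpha> g vs"
  let ?diag = "mat_diag n (\<lambda>j. complex_of_real (H (vs ! j)))"
  have len: "length vs = n" using length_enumerates[OF vs] card_verts by simp
  have "index_mat vs (\<lambda>u v. kdelta u v * (\<mu> - of_real (H u))) = \<mu> \<cdot>\<^sub>m 1\<^sub>m n - ?diag"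
    unfolding one_mat_eq_index_mat[OF vs] mat_diag_eq_index_mat[OF vs] smult_index_mat index_mat_diff
    by (simp add: right_diff_distrib mult.commute)
  then have one: "1\<^sub>m d \<otimes>\<^sub>K index_mat vs (\<lambda>u v. kdelta u v * (\<mu> - of_real (H u))) =
      \<mu> \<cdot>\<^sub>m 1\<^sub>m (n * d) - 1\<^sub>m d \<otimes>\<^sub>K ?diag"
    by (simp add: kronecker_diff_right[of _ n n] kronecker_smult_right kronecker_one mult.commute)
  have "?S = index_mat (List.product [0..<d] vs)
      (\<lambda>p q. \<Sum>g\<in>carrier \<Gamma>. kron (curry (($$) (\<rho> g))) (hopping_part g) p q)"
    unfolding hermitian_part_mat_eq
    by (rule finsum_kronecker_index_mat[OF group_finite representation_carrier[OF \<rho>]])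
      (simp_all add: len)
  then have "?S \<in> carrier_mat (n * d) (n * d)"
    using index_mat_carrier[of "List.product [0..<d] vs"] by (simp add: len mult.commute)
  moreover have "1\<^sub>m d \<otimes>\<^sub>K ?diag \<in> carrier_mat (n * d) (n * d)"
    by (simp add: kronecker_def carrier_matD[OF mat_diag_dim] mult.commute)
  ultimately have "\<mu> \<cdot>\<^sub>m 1\<^sub>m (n * d) - ?S - 1\<^sub>m d \<otimes>\<^sub>K ?diag =
      1\<^sub>m d \<otimes>\<^sub>K index_mat vs (\<lambda>u v. kdelta u v * (\<mu> - of_real (H u))) - ?S"
    unfolding one by (intro eq_matI) auto
  then show ?thesis
    using det_minus_finsum_kronecker[OF \<rho> group_finite vs, of "n * d"
      "\<lambda>u v. kdelta u v * (\<mu> - of_real (H u))" hopping_part]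
    by (simp add: card_verts hermitian_part_mat_eq hopping_pencil_def[abs_def] mult.commute)
qed

lemma det_bond_scattering_trivial:
  assumes triv: "\<forall>g\<in>carrier \<Gamma>. \<rho> g = 1\<^sub>m 1" and rep: "group_representation \<Gamma> 1 \<rho>"
    and es: "enumerates es (parcs G)"
  shows "det (1\<^sub>m (2 * m) - bond_scattering_mat G H h \<gamma> \<mu> es) =
      twisted_det \<Gamma> 1 \<rho> (parcs G) bond_scattering_pencil"
proof -
  have "(\<Oplus>\<^bsub>module_mat TYPE(complex) (2 * m) (2 * m)\<^esub> g \<in> carrier \<Gamma>.
        \<rho> g \<otimes>\<^sub>K bond_scattering_part_mat G H h \<gamma> \<mu> \<alpha> g es) =
      index_mat es (\<lambda>e f. \<Sum>g\<in>carrier \<Gamma>. bond_scattering_part g e f)"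
    unfolding bond_scattering_part_mat_eq using triv length_enumerates[OF es] card_arcs
    by (intro finsum_trivial_kronecker_index_mat[OF group_finite]) simp_all
  also have "\<dots> = bond_scattering_mat G H h \<gamma> \<mu> es"
    unfolding bond_scattering_mat_eq index_mat_eq_rect_mat
    using es group_finite voltage_closed by (intro rect_mat_cong) (simp add: enumerates_def)
  finally show ?thesis
    using det_bond_scattering_parts[OF rep es] by simp
qed

lemma det_hermitian_trivial:
  assumes triv: "\<forall>g\<in>carrier \<Gamma>. \<rho> g = 1\<^sub>m 1" and rep: "group_representation \<Gamma> 1 \<rho>"
    and vs: "enumerates vs (pverts G)"
  shows "det (\<mu> \<cdot>\<^sub>m 1\<^sub>m n - hermitian_mat G H h \<gamma> vs) = twisted_det \<Gamma> 1 \<rho> (pverts G) hopping_pencil"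
proof -
  have "(\<Oplus>\<^bsub>module_mat TYPE(complex) n n\<^esub> g \<in> carrier \<Gamma>. \<rho> g \<otimes>\<^sub>K hermitian_part_mat G h \<gamma> \<alpha> g vs) =
      index_mat vs (\<lambda>u v. \<Sum>g\<in>carrier \<Gamma>. hopping_part g u v)"
    unfolding hermitian_part_mat_eq using triv length_enumerates[OF vs] card_verts
    by (intro finsum_trivial_kronecker_index_mat[OF group_finite]) simp_all
  also have "(\<lambda>u v. \<Sum>g\<in>carrier \<Gamma>. hopping_part g u v) = hopping"
    using group_finite voltage_closed by (intro ext) (simp add: hopping_def)
  finally have sum: "(\<Oplus>\<^bsub>module_mat TYPE(complex) n n\<^esub> g \<in> carrier \<Gamma>.
        \<rho> g \<otimes>\<^sub>K hermitian_part_mat G h \<gamma> \<alpha> g vs) =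
      index_mat vs hopping" .
  have "\<mu> \<cdot>\<^sub>m 1\<^sub>m n - index_mat vs hopping - mat_diag n (\<lambda>j. of_real (H (vs ! j))) =
      \<mu> \<cdot>\<^sub>m 1\<^sub>m n - hermitian_mat G H h \<gamma> vs"
    unfolding one_mat_eq_index_mat[OF vs] mat_diag_eq_index_mat[OF vs] hermitian_mat_eq
      smult_index_mat index_mat_diff
    by (simp add: algebra_simps)
  then show ?thesis
    using det_hermitian_parts[OF rep vs] by (simp add: sum kronecker_one_left[unfolded One_nat_def])
qed

lemma twisted_arcs_representation:
  assumes \<rho>: "group_representation \<Gamma> d \<rho>"
  shows "twisted_arcs (parcs G) {..<d} (\<lambda>e. curry (($$) (\<rho> (\<alpha> e))))"
proof
  fix e a b assume e: "e \<in> parcs G" and ab: "a \<in> {..<d}" "b \<in> {..<d}"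
  have "\<rho> (\<alpha> e) * \<rho> (\<alpha> (prod.swap e)) = 1\<^sub>m d"
    using e by (simp add: voltage_closed voltage_swap representation_one[OF \<rho>]
      flip: representation_mult[OF \<rho>])
  then show "mult_on {..<d} (curry (($$) (\<rho> (\<alpha> e)))) (curry (($$) (\<rho> (\<alpha> (prod.swap e))))) a b =
      kdelta a b"
    using e ab arc_swap representation_carrier[OF \<rho>] voltage_closed
    by (subst mult_on_curry_mat[of _ d d _ d]) (auto simp: kdelta_def)
qed (use arcs_finite arc_swap arc_no_loop in auto)

lemma twisted_det_hopping_pencil:
  assumes \<rho>: "group_representation \<Gamma> d \<rho>"
  shows "(-1) ^ (n * d) * twisted_det \<Gamma> d \<rho> (pverts G) hopping_pencil =
    det_on ({..<d} \<times> pverts G) (\<lambda>(b, u) (b', v).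
      kdelta (b, u) (b', v) * (resolvent_denom G H h \<mu> u + \<i> * of_real (out_weight G h u))
      + (if (u, v) \<in> parcs G then (amplitude (u, v))\<^sup>2 * \<rho> (\<alpha> (u, v)) $$ (b, b') else 0))"
    (is "_ = det_on ?X ?F")
proof -
  have "(-1) ^ (n * d) * twisted_det \<Gamma> d \<rho> (pverts G) hopping_pencil =
      det_on ?X (\<lambda>p q. - (\<Sum>g\<in>carrier \<Gamma>. kron (curry (($$) (\<rho> g))) (hopping_pencil g) p q))"
    by (simp add: det_on_uminus twisted_det_def card_cartesian_product card_verts mult.commute)
  also have "\<dots> = det_on ?X ?F"
  proof (rule det_on_cong)
    fix p q assume "p \<in> ?X" "q \<in> ?X"
    then obtain b u b' v where p: "p = (b, u)" "q = (b', v)" "b < d" "b' < d" by auto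
    have "(\<Sum>g\<in>carrier \<Gamma>. \<rho> g $$ (b, b') * hopping_pencil g u v) =
        kdelta b b' * (kdelta u v * (\<mu> - of_real (H u))) - \<rho> (\<alpha> (u, v)) $$ (b, b') * hopping u v"
      unfolding hopping_pencil_def
      by (rule sum_representation_pencil[OF \<rho> group_finite p(3,4)])
        (use voltage_closed in \<open>auto simp: hopping_def split: if_splits\<close>)
    then show "- (\<Sum>g\<in>carrier \<Gamma>. kron (curry (($$) (\<rho> g))) (hopping_pencil g) p q) = ?F p q"
      by (simp add: p(1,2) kron_def kdelta_Pair hopping_eq_amplitude resolvent_denom_def)
        (simp add: algebra_simps)
  qed
  finally show ?thesis .
qed

lemma twisted_det_bond_scattering_pencil:
  assumes \<rho>: "group_representation \<Gamma> d \<rho>"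
  shows "twisted_det \<Gamma> d \<rho> (parcs G) bond_scattering_pencil =
    (2 ^ m * (-1) ^ n / (\<Prod>u\<in>pverts G. resolvent_denom G H h \<mu> u)) ^ d *
      twisted_det \<Gamma> d \<rho> (pverts G) hopping_pencil"
proof -
  let ?D = "resolvent_denom G H h \<mu>"
  interpret twisted_arcs "parcs G" "{..<d}" "\<lambda>e. curry (($$) (\<rho> (\<alpha> e)))"
    by (rule twisted_arcs_representation[OF \<rho>])
  have "twisted_det \<Gamma> d \<rho> (parcs G) bond_scattering_pencil =
      det_on ({..<d} \<times> parcs G) (\<lambda>(a, e) (b, f). kdelta (a, e) (b, f) - curry (($$) (\<rho> (\<alpha> e))) a b *
        (if snd e = fst f
         then \<i> * kdelta (prod.swap e) f - (1 - \<i>\<^sup>2) * (amplitude e * amplitude f / ?D (snd e))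
         else 0))"
    unfolding twisted_det_def
    by (intro det_on_cong)
      (auto simp: kron_def bond_scattering_pencil_def kdelta_Pair bond_scattering_eq_amplitude
        sum_representation_pencil[OF \<rho> group_finite] voltage_closed)
  also have "\<dots> = 2 ^ (m * d) / prod ?D (pverts G) ^ d *
      ((-1) ^ (n * d) * twisted_det \<Gamma> d \<rho> (pverts G) hopping_pencil)"
    using det_one_minus_bond_scattering[where c = \<i> and w = amplitude and D = ?D,
        OF verts_finite arcs_subset denom_nonzero card_arcs]
    unfolding twisted_det_hopping_pencil[OF \<rho>] curry_conv sum_amplitude_mult_swap card_lessThan by simp
  finally show ?thesis
    by (simp add: power_mult_distrib power_divide power_mult)
qed

definition lift_arc :: "'g \<times> 'a \<times> 'a \<Rightarrow> ('a \<times> 'g) \<times> 'a \<times> 'g" where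
  "lift_arc = (\<lambda>(g, e). ((fst e, g), (snd e, g \<otimes> \<alpha> e)))"

lemma bij_betw_lift_arc: "bij_betw lift_arc (carrier \<Gamma> \<times> parcs G) (parcs (derived_graph G \<Gamma> \<alpha>))"
  unfolding bij_betw_def
proof
  show "inj_on lift_arc (carrier \<Gamma> \<times> parcs G)"
    by (auto simp: inj_on_def lift_arc_def)
  show "lift_arc ` (carrier \<Gamma> \<times> parcs G) = parcs (derived_graph G \<Gamma> \<alpha>)"
    by (force simp: lift_arc_def derived_graph_def)
qed

lemma bij_betw_lift_arc_star:
  assumes "g \<in> carrier \<Gamma>"
  shows "bij_betw (\<lambda>e. lift_arc (g, e)) {e \<in> parcs G. fst e = u}
      {f \<in> parcs (derived_graph G \<Gamma> \<alpha>). fst f = (u, g)}"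
  unfolding bij_betw_def
proof
  show "inj_on (\<lambda>e. lift_arc (g, e)) {e \<in> parcs G. fst e = u}"
    by (auto simp: inj_on_def lift_arc_def)
  show "(\<lambda>e. lift_arc (g, e)) ` {e \<in> parcs G. fst e = u} =
      {f \<in> parcs (derived_graph G \<Gamma> \<alpha>). fst f = (u, g)}"
    using assms by (force simp: lift_arc_def derived_graph_def)
qed

lemma lift_arc_data_lift_arc: "lift_arc_data k (lift_arc (g, e)) = k e"
  by (simp add: lift_arc_data_def lift_arc_def)

lemma resolvent_denom_derived:
  assumes "g \<in> carrier \<Gamma>"
  shows "resolvent_denom (derived_graph G \<Gamma> \<alpha>) (lift_vertex_data H) (lift_arc_data h) \<mu> (u, g) =
    resolvent_denom G H h \<mu> u"
  using sum.reindex_bij_betw[OF bij_betw_lift_arc_star[OF assms], of "lift_arc_data h" u]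
  by (simp add: resolvent_denom_def lift_vertex_data_def out_weight_def lift_arc_data_lift_arc)

lemma swap_lift_arc_eq_iff:
  assumes "g \<in> carrier \<Gamma>" "e \<in> parcs G" "snd (lift_arc (g, e)) = fst (lift_arc (g', f))"
  shows "prod.swap (lift_arc (g, e)) = lift_arc (g', f) \<longleftrightarrow> prod.swap e = f"
proof
  assume "prod.swap (lift_arc (g, e)) = lift_arc (g', f)"
  then show "prod.swap e = f" by (auto simp: lift_arc_def prod_eq_iff)
next
  assume f: "prod.swap e = f"
  then have "\<alpha> f = inv (\<alpha> e)" using voltage_swap[OF assms(2)] by simp
  then show "prod.swap (lift_arc (g, e)) = lift_arc (g', f)"
    using assms voltage_closed[OF assms(2)] by (auto simp: lift_arc_def m_assoc simp flip: f)
qed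

lemma scattering_lift_arc:
  assumes g: "g \<in> carrier \<Gamma>" and e: "e \<in> parcs G"
    and consecutive: "snd (lift_arc (g, e)) = fst (lift_arc (g', f))"
  shows "scattering (derived_graph G \<Gamma> \<alpha>) (lift_vertex_data H) (lift_arc_data h) (lift_arc_data \<gamma>) \<mu>
      (snd (lift_arc (g, e))) (lift_arc (g, e)) (lift_arc (g', f)) = scattering G H h \<gamma> \<mu> (snd e) e f"
proof -
  have "snd (lift_arc (g, e)) = (snd e, g \<otimes> \<alpha> e)" by (simp add: lift_arc_def)
  then show ?thesis
    using g voltage_closed[OF e] swap_lift_arc_eq_iff[OF assms]
    by (simp add: scattering_def resolvent_denom_derived lift_arc_data_lift_arc)
qed

lemma det_derived_bond_scattering:
  assumes es': "enumerates es' (parcs (derived_graph G \<Gamma> \<alpha>))"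
  shows "det (1\<^sub>m (2 * m * Coset.order \<Gamma>) - bond_scattering_mat (derived_graph G \<Gamma> \<alpha>)
              (lift_vertex_data H) (lift_arc_data h) (lift_arc_data \<gamma>) \<mu> es') =
    det_on (carrier \<Gamma> \<times> parcs G) (\<lambda>(g, e) (g', f). bond_scattering_pencil (inv g \<otimes> g') e f)"
proof -
  let ?G = "derived_graph G \<Gamma> \<alpha>"
  let ?s = "scattering ?G (lift_vertex_data H) (lift_arc_data h) (lift_arc_data \<gamma>) \<mu>"
  let ?F = "\<lambda>e f. kdelta e f - (if snd e = fst f then ?s (snd e) e f else 0)"
  have fin: "finite (carrier \<Gamma> \<times> parcs G)" using group_finite arcs_finite by simp
  have "card (parcs ?G) = 2 * m * Coset.order \<Gamma>"
    using bij_betw_same_card[OF bij_betw_lift_arc] card_arcs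
    by (simp add: card_cartesian_product Coset.order_def mult.commute)
  then have one: "1\<^sub>m (2 * m * Coset.order \<Gamma>) = index_mat es' kdelta"
    using index_mat_kdelta[OF es'] by simp
  have "det (1\<^sub>m (2 * m * Coset.order \<Gamma>) - bond_scattering_mat ?G
      (lift_vertex_data H) (lift_arc_data h) (lift_arc_data \<gamma>) \<mu> es') = det_on (parcs ?G) ?F"
    unfolding bond_scattering_mat_def one index_mat_diff by (rule det_index_mat[OF es'])
  also have "\<dots> = det_on (carrier \<Gamma> \<times> parcs G) (\<lambda>x y. ?F (lift_arc x) (lift_arc y))"
    by (rule det_on_reindex[OF fin bij_betw_lift_arc, symmetric])
  also have "\<dots> =
      det_on (carrier \<Gamma> \<times> parcs G) (\<lambda>(g, e) (g', f). bond_scattering_pencil (inv g \<otimes> g') e f)"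
  proof (rule det_on_cong)
    fix x y assume xy: "x \<in> carrier \<Gamma> \<times> parcs G" "y \<in> carrier \<Gamma> \<times> parcs G"
    then obtain g e g' f where x: "x = (g, e)" "y = (g', f)" "g \<in> carrier \<Gamma>" "e \<in> parcs G"
      "g' \<in> carrier \<Gamma>" "f \<in> parcs G" by auto
    have "kdelta k (inv g \<otimes> g') = (kdelta (g \<otimes> k) g' :: complex)" if "k \<in> carrier \<Gamma>" for k
      using inv_solve_left[OF that x(3,5)] by (auto simp: kdelta_def)
    then have pencil: "bond_scattering_pencil (inv g \<otimes> g') e f =
        kdelta x y - kdelta (g \<otimes> \<alpha> e) g' * bond_scattering e f"
      using x voltage_closed[OF x(4)] by (simp add: bond_scattering_pencil_def kdelta_Pair)
    have "kdelta (lift_arc x) (lift_arc y) = (kdelta x y :: complex)"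
      using xy bij_betw_imp_inj_on[OF bij_betw_lift_arc] by (auto simp: kdelta_def inj_on_def)
    moreover have "snd (lift_arc x) = fst (lift_arc y) \<longleftrightarrow> snd e = fst f \<and> g \<otimes> \<alpha> e = g'"
      by (auto simp: x(1,2) lift_arc_def)
    then have "(if snd (lift_arc x) = fst (lift_arc y)
        then ?s (snd (lift_arc x)) (lift_arc x) (lift_arc y) else 0) =
        kdelta (g \<otimes> \<alpha> e) g' * bond_scattering e f"
      using scattering_lift_arc[OF x(3,4), of g' f] by (simp add: x(1,2) bond_scattering_def kdelta_def)
    ultimately show "?F (lift_arc x) (lift_arc y) =
        (case x of (g, e) \<Rightarrow> \<lambda>(g', f). bond_scattering_pencil (inv g \<otimes> g') e f) y"
      by (simp add: x(1,2) pencil)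
  qed
  finally show ?thesis .
qed

lemma det_derived_bond_scattering_factorization:
  assumes "all_irreducible_representations \<Gamma> k f \<rho>" "enumerates es' (parcs (derived_graph G \<Gamma> \<alpha>))"
  shows "det (1\<^sub>m (2 * m * Coset.order \<Gamma>) - bond_scattering_mat (derived_graph G \<Gamma> \<alpha>)
              (lift_vertex_data H) (lift_arc_data h) (lift_arc_data \<gamma>) \<mu> es') =
    (\<Prod>i = 1..k. twisted_det \<Gamma> (f i) (\<rho> i) (parcs G) bond_scattering_pencil ^ f i)"
  unfolding det_derived_bond_scattering[OF assms(2)]
  by (rule group_determinant_factorization[OF assms(1) group_finite arcs_finite])

lemma prod_twisted_det_bond_scattering_pencil:
  assumes irr: "all_irreducible_representations \<Gamma> k f \<rho>"
  shows "(\<Prod>i = 1..k. twisted_det \<Gamma> (f i) (\<rho> i) (parcs G) bond_scattering_pencil ^ f i) =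
    (2 ^ m * (-1) ^ n / (\<Prod>u\<in>pverts G. resolvent_denom G H h \<mu> u)) ^ Coset.order \<Gamma> *
      (\<Prod>i = 1..k. twisted_det \<Gamma> (f i) (\<rho> i) (pverts G) hopping_pencil ^ f i)"
proof -
  let ?c = "2 ^ m * (-1) ^ n / (\<Prod>u\<in>pverts G. resolvent_denom G H h \<mu> u)"
  have "(\<Prod>i = 1..k. twisted_det \<Gamma> (f i) (\<rho> i) (parcs G) bond_scattering_pencil ^ f i) =
      (\<Prod>i = 1..k. ?c ^ (f i)\<^sup>2 * twisted_det \<Gamma> (f i) (\<rho> i) (pverts G) hopping_pencil ^ f i)"
    by (intro prod.cong refl)
      (simp only: twisted_det_bond_scattering_pencil[OF all_irreducible_imp_representation[OF irr]]
        power_mult_distrib power2_eq_square power_mult)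
  then show ?thesis
    by (simp only: prod.distrib power_sum[symmetric] sum_degree_squares[OF irr group_finite])
qed

end

theorem theorem6:
  fixes G :: "'a pair_pre_digraph"
    and H :: "'a \<Rightarrow> real"
    and h \<gamma> :: "'a \<times> 'a \<Rightarrow> real"
    and \<Gamma> :: "('g, 'b) monoid_scheme"
    and \<alpha> :: "'a \<times> 'a \<Rightarrow> 'g"
    and \<rho> :: "nat \<Rightarrow> 'g \<Rightarrow> complex mat"
    and f :: "nat \<Rightarrow> nat"
    and n m p k :: nat
    and \<mu> :: complex
    and vs :: "'a list"
    and es :: "('a \<times> 'a) list"
    and es' :: "(('a \<times> 'g) \<times> ('a \<times> 'g)) list"
  assumes "pair_graph G" and "Digraph_Component.connected (with_proj G)"
    and "card (pverts G) = n" and "card (parcs G) = 2 * m"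
    and "arc_data G h \<gamma>"
    and "group \<Gamma>" and "finite (carrier \<Gamma>)" and "Coset.order \<Gamma> = p"
    and "voltage_assignment G \<Gamma> \<alpha>"
    and "all_irreducible_representations \<Gamma> k f \<rho>"
    and "f 1 = 1" and "\<forall>g \<in> carrier \<Gamma>. \<rho> 1 g = 1\<^sub>m 1"
    and "\<forall>u \<in> pverts G. resolvent_denom G H h \<mu> u \<noteq> 0"
    and "Digraph_Component.connected (with_proj (derived_graph G \<Gamma> \<alpha>))"
    and "enumerates vs (pverts G)"
    and "enumerates es (parcs G)"
    and "enumerates es' (parcs (derived_graph G \<Gamma> \<alpha>))"
  shows
    "det (1\<^sub>m (2 * m * p)
          - bond_scattering_mat (derived_graph G \<Gamma> \<alpha>)
              (lift_vertex_data H) (lift_arc_data h) (lift_arc_data \<gamma>) \<mu> es')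
     = det (1\<^sub>m (2 * m) - bond_scattering_mat G H h \<gamma> \<mu> es)
       * (\<Prod>i = 2..k.
            det (1\<^sub>m (2 * m * f i)
                 - (\<Oplus>\<^bsub>module_mat TYPE(complex) (2 * m * f i) (2 * m * f i)\<^esub> g \<in> carrier \<Gamma>.
                      \<rho> i g \<otimes>\<^sub>K bond_scattering_part_mat G H h \<gamma> \<mu> \<alpha> g es)) ^ f i)
     \<and>
     det (1\<^sub>m (2 * m) - bond_scattering_mat G H h \<gamma> \<mu> es)
       * (\<Prod>i = 2..k.
            det (1\<^sub>m (2 * m * f i)
                 - (\<Oplus>\<^bsub>module_mat TYPE(complex) (2 * m * f i) (2 * m * f i)\<^esub> g \<in> carrier \<Gamma>.
                      \<rho> i g \<otimes>\<^sub>K bond_scattering_part_mat G H h \<gamma> \<mu> \<alpha> g es)) ^ f i)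
     = 2 ^ (m * p) * (-1) ^ (n * p) * det (\<mu> \<cdot>\<^sub>m 1\<^sub>m n - hermitian_mat G H h \<gamma> vs)
         / (\<Prod>u \<in> pverts G. resolvent_denom G H h \<mu> u ^ p)
       * (\<Prod>i = 2..k.
            det (\<mu> \<cdot>\<^sub>m 1\<^sub>m (n * f i)
                 - (\<Oplus>\<^bsub>module_mat TYPE(complex) (n * f i) (n * f i)\<^esub> g \<in> carrier \<Gamma>.
                      \<rho> i g \<otimes>\<^sub>K hermitian_part_mat G h \<gamma> \<alpha> g vs)
                 - 1\<^sub>m (f i) \<otimes>\<^sub>K mat_diag n (\<lambda>j. of_real (H (vs ! j)))) ^ f i)"
proof -
  interpret voltage_graph G H h \<gamma> \<mu> \<Gamma> \<alpha> n m
    using assms by (simp add: voltage_graph_def weighted_graph_def voltage_graph_axioms_def)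
  note irr = assms(10) and rep = all_irreducible_imp_representation[OF assms(10)]
  have k: "0 < k" by (rule number_of_irreducibles_pos[OF irr group_finite])
  have split: "(\<Prod>i = 1..k. F i ^ f i) = F 1 * (\<Prod>i = 2..k. K i ^ f i)" if "\<And>i. i \<in> {1..k} \<Longrightarrow> K i = F i"
    for F K :: "nat \<Rightarrow> complex"
    using k assms(11) that by (simp add: prod.atLeast_Suc_atMost numeral_2_eq_2)
  note bonds = split[OF det_bond_scattering_parts[OF rep assms(16)]]
    and hops = split[OF det_hermitian_parts[OF rep assms(15)]]
  have rep_1: "group_representation \<Gamma> 1 (\<rho> 1)" using rep[of 1] k assms(11) by simp
  note trivial = det_bond_scattering_trivial[OF assms(12) rep_1 assms(16)]
    det_hermitian_trivial[OF assms(12) rep_1 assms(15)]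
  show ?thesis
    using det_derived_bond_scattering_factorization[OF irr assms(17)]
      prod_twisted_det_bond_scattering_pencil[OF irr]
    by (simp only: bonds hops trivial assms(8,11))
      (simp add: power_mult_distrib power_divide prod_power_distrib power_mult)
qed

end
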